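(* There is an absolute constant $c > 0$ such that the following holds. Suppose $\Phi:\mathrm{Mat}(p)\to\mathrm{Mat}(n)$ is an $(\varepsilon, 1-\lambda)$-quantum expander with $\lambda\in(0,1]$ and $\varepsilon\sqrt{p}/\lambda \leq c$. Then there are $L \in \mathrm{GL}(p)$, $R\in\mathrm{GL}(n)$ with $\det L = \det R = 1$ such that $\Phi_{L,R}$ is doubly balanced and $$\|I_p - L^\dagger L\|_F = O(\varepsilon\sqrt{p}/\lambda), \qquad \|I_n - R^\dagger R\|_{op} = O(\varepsilon\sqrt{p}/\lambda),$$ where the implied constants are absolute.
   Context: A completely positive map $\Phi:\mathrm{Mat}(p)\to\mathrm{Mat}(n)$ is $\Phi(Y) = \sum_{i=1}^r A_i Y A_i^\dagger$ with $A_i \in \mathbb{C}^{n\times p}$; $s(\Phi) = \operatorname{tr}\Phi(I_p)$; $\Phi^*(Y) = \sum_i A_i^\dagger Y A_i$. $\Phi$ is $\varepsilon$-doubly balanced if $\|\Phi(I_p) - s(\Phi) I_n/n\|_{op} \leq s(\Phi)\varepsilon/n$ and $\|\Phi^*(I_n) - s(\Phi)I_p/p\|_{op} \leq s(\Phi)\varepsilon/p$; doubly balanced means $0$-doubly balanced. $\Phi$ is an $(\varepsilon,1-\lambda)$-quantum expander if it is $\varepsilon$-doubly balanced and $\|\Phi(X)\|_F \leq (1-\lambda)\frac{s(\Phi)}{\sqrt{np}}\|X\|_F$ for all Hermitian $p\times p$ $X$ with $\operatorname{tr}X=0$. For $L\in\mathrm{GL}(p)$, $R\in\mathrm{GL}(n)$,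 the scaling is $\Phi_{L,R}(X) = R\,\Phi(L^\dagger X L)\,R^\dagger$. *)

theory Defs
  imports Complex_Main "Jordan_Normal_Form.Schur_Decomposition"
begin

text \<open>Matrices are those of \<open>Jordan_Normal_Form\<close>, whose dimensions are natural numbers rather than
  types, so that the dimensions can be quantified inside the scope of absolute constants.\<close>

definition mat_trace :: "complex mat \<Rightarrow> complex" where
  "mat_trace A = (\<Sum>i<dim_row A. A $$ (i, i))"

definition hermitian_mat :: "complex mat \<Rightarrow> bool" where
  "hermitian_mat A \<longleftrightarrow> mat_adjoint A = A"

definition frob_norm :: "complex mat \<Rightarrow> real" where
  "frob_norm A = sqrt (\<Sum>i<dim_row A. \<Sum>j<dim_col A. (cmod (A $$ (i, j)))\<^sup>2)"

definition l2_norm_vec :: "complex vec \<Rightarrow> real" where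
  "l2_norm_vec v = sqrt (\<Sum>i<dim_vec v. (cmod (v $ i))\<^sup>2)"

definition op_norm_mat :: "complex mat \<Rightarrow> real" where
  "op_norm_mat A = Sup {l2_norm_vec (A *\<^sub>v v) | v. v \<in> carrier_vec (dim_col A) \<and> l2_norm_vec v \<le> 1}"

definition kraus_map :: "nat \<Rightarrow> complex mat list \<Rightarrow> complex mat \<Rightarrow> complex mat" where
  "kraus_map n As Y = mat n n (\<lambda>ij. \<Sum>A\<leftarrow>As. (A * Y * mat_adjoint A) $$ ij)"

definition kraus_dual :: "nat \<Rightarrow> complex mat list \<Rightarrow> complex mat \<Rightarrow> complex mat" where
  "kraus_dual p As Y = mat p p (\<lambda>ij. \<Sum>A\<leftarrow>As. (mat_adjoint A * Y * A) $$ ij)"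

text \<open>A map from \<open>p \<times> p\<close> to \<open>n \<times> n\<close> matrices is a function on all matrices of which only the
  values on \<open>carrier_mat p p\<close> matter.\<close>

definition kraus_rep :: "nat \<Rightarrow> nat \<Rightarrow> (complex mat \<Rightarrow> complex mat) \<Rightarrow> complex mat list \<Rightarrow> bool" where
  "kraus_rep p n \<Phi> As \<longleftrightarrow>
     set As \<subseteq> carrier_mat n p \<and> (\<forall>Y \<in> carrier_mat p p. \<Phi> Y = kraus_map n As Y)"

definition completely_positive :: "nat \<Rightarrow> nat \<Rightarrow> (complex mat \<Rightarrow> complex mat) \<Rightarrow> bool" where
  "completely_positive p n \<Phi> \<longleftrightarrow> (\<exists>As. kraus_rep p n \<Phi> As)"

text \<open>The choice of the Kraus operators is immaterial, see \<open>dual_map_eq\<close> below.\<close>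

definition dual_map ::
  "nat \<Rightarrow> nat \<Rightarrow> (complex mat \<Rightarrow> complex mat) \<Rightarrow> complex mat \<Rightarrow> complex mat" where
  "dual_map p n \<Phi> = kraus_dual p (SOME As. kraus_rep p n \<Phi> As)"

text \<open>The trace is real for completely positive \<open>\<Phi>\<close>, see \<open>map_size_complex\<close> below.\<close>

definition map_size :: "nat \<Rightarrow> (complex mat \<Rightarrow> complex mat) \<Rightarrow> real" where
  "map_size p \<Phi> = Re (mat_trace (\<Phi> (1\<^sub>m p)))"

definition eps_doubly_balanced ::
  "nat \<Rightarrow> nat \<Rightarrow> real \<Rightarrow> (complex mat \<Rightarrow> complex mat) \<Rightarrow> bool" where
  "eps_doubly_balanced p n \<epsilon> \<Phi> \<longleftrightarrow>
     op_norm_mat (\<Phi> (1\<^sub>m p) - complex_of_real (map_size p \<Phi> / real n) \<cdot>\<^sub>m 1\<^sub>m n)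
       \<le> map_size p \<Phi> * \<epsilon> / real n \<and>
     op_norm_mat (dual_map p n \<Phi> (1\<^sub>m n) - complex_of_real (map_size p \<Phi> / real p) \<cdot>\<^sub>m 1\<^sub>m p)
       \<le> map_size p \<Phi> * \<epsilon> / real p"

definition doubly_balanced :: "nat \<Rightarrow> nat \<Rightarrow> (complex mat \<Rightarrow> complex mat) \<Rightarrow> bool" where
  "doubly_balanced p n \<Phi> \<longleftrightarrow> eps_doubly_balanced p n 0 \<Phi>"

text \<open>The parameter \<open>\<mu>\<close> plays the role of \<open>1 - \<lambda>\<close>.\<close>

definition quantum_expander ::
  "nat \<Rightarrow> nat \<Rightarrow> real \<Rightarrow> real \<Rightarrow> (complex mat \<Rightarrow> complex mat) \<Rightarrow> bool" where
  "quantum_expander p n \<epsilon> \<mu> \<Phi> \<longleftrightarrow>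
     eps_doubly_balanced p n \<epsilon> \<Phi> \<and>
     (\<forall>X \<in> carrier_mat p p. hermitian_mat X \<and> mat_trace X = 0 \<longrightarrow>
        frob_norm (\<Phi> X) \<le> \<mu> * (map_size p \<Phi> / sqrt (real n * real p)) * frob_norm X)"

definition scaling ::
  "(complex mat \<Rightarrow> complex mat) \<Rightarrow> complex mat \<Rightarrow> complex mat \<Rightarrow> complex mat \<Rightarrow> complex mat" where
  "scaling \<Phi> L R X = R * \<Phi> (mat_adjoint L * X * L) * mat_adjoint R"


lemma mat_adjoint_carrier:
  "A \<in> carrier_mat n p \<Longrightarrow> mat_adjoint A \<in> carrier_mat p n"
  unfolding mat_adjoint_def carrier_mat_def by simp

lemma dim_mat_adjoint [simp]:
  "dim_row (mat_adjoint A) = dim_col A" "dim_col (mat_adjoint A) = dim_row A"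
  unfolding mat_adjoint_def by simp_all

lemma index_mat_adjoint:
  assumes "i < dim_col A" "j < dim_row A"
  shows "mat_adjoint A $$ (i, j) = cnj (A $$ (j, i))"
  using assms unfolding mat_adjoint_def by (simp add: mat_of_rows_index)

lemma mat_adjoint_mult:
  assumes "A \<in> carrier_mat n m" "B \<in> carrier_mat m p"
  shows "mat_adjoint (A * B) = mat_adjoint B * mat_adjoint (A :: complex mat)"
proof (rule eq_matI)
  fix i j assume "i < dim_row (mat_adjoint B * mat_adjoint A)" "j < dim_col (mat_adjoint B * mat_adjoint A)"
  with assms have ij: "i < p" "j < n" by auto
  show "mat_adjoint (A * B) $$ (i, j) = (mat_adjoint B * mat_adjoint A) $$ (i, j)"
    using assms ij by (simp add: index_mat_adjoint scalar_prod_def mult.commute)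
qed (use assms in auto)

lemma mat_adjoint_adjoint: "mat_adjoint (mat_adjoint A) = (A :: complex mat)"
  by (rule eq_matI) (auto simp: index_mat_adjoint)

lemma index_sandwich:
  assumes "B \<in> carrier_mat a b" "Y \<in> carrier_mat b c" "C \<in> carrier_mat c d" "i < a" "j < d"
  shows "(B * Y * C) $$ (i, j) = (\<Sum>l<c. \<Sum>k<b. B $$ (i, k) * Y $$ (k, l) * (C $$ (l, j) :: complex))"
  using assms by (simp add: scalar_prod_def sum_distrib_right atLeast0LessThan del: assoc_mult_mat)

lemma kraus_dual_index:
  assumes As: "set As \<subseteq> carrier_mat n p" and Y: "Y \<in> carrier_mat n n" and ij: "i < p" "j < p"
  shows "kraus_dual p As Y $$ (i, j) =
    (\<Sum>l<n. \<Sum>k<n. Y $$ (k, l) * kraus_map n As (mat p p (\<lambda>ab. if ab = (j, i) then 1 else 0)) $$ (l, k))"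
proof -
  let ?E = "mat p p (\<lambda>ab. if ab = (j, i) then 1 else 0) :: complex mat"
  have E: "(A * ?E * mat_adjoint A) $$ (l, k) = A $$ (l, j) * cnj (A $$ (k, i))"
    if A: "A \<in> set As" and lk: "l < n" "k < n" for A l k
  proof -
    have Ac: "A \<in> carrier_mat n p" using As A by auto
    have "(A * ?E * mat_adjoint A) $$ (l, k)
        = (\<Sum>y<p. \<Sum>x<p. A $$ (l, x) * ?E $$ (x, y) * mat_adjoint A $$ (y, k))"
      using lk Ac by (intro index_sandwich) (auto intro: mat_adjoint_carrier)
    also have "\<dots> = (\<Sum>y<p. \<Sum>x<p. if x = j then (if y = i then A $$ (l, x) * mat_adjoint A $$ (y, k) else 0) else 0)"
      by (intro sum.cong) auto
    also have "\<dots> = A $$ (l, j) * mat_adjoint A $$ (i, k)"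
      using ij by (simp add: sum.delta)
    finally show ?thesis using Ac lk ij by (simp add: index_mat_adjoint)
  qed
  have S: "kraus_map n As ?E $$ (l, k) = (\<Sum>A\<leftarrow>As. A $$ (l, j) * cnj (A $$ (k, i)))"
    if "l < n" "k < n" for l k
    unfolding kraus_map_def using that E by (auto intro!: arg_cong[where f = sum_list])
  have D: "(mat_adjoint A * Y * A) $$ (i, j) = (\<Sum>l<n. \<Sum>k<n. Y $$ (k, l) * (A $$ (l, j) * cnj (A $$ (k, i))))"
    if A: "A \<in> set As" for A
  proof -
    have Ac: "A \<in> carrier_mat n p" using As A by auto
    have "(mat_adjoint A * Y * A) $$ (i, j)
        = (\<Sum>l<n. \<Sum>k<n. mat_adjoint A $$ (i, k) * Y $$ (k, l) * A $$ (l, j))"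
      using Ac Y ij by (intro index_sandwich) (auto intro: mat_adjoint_carrier)
    also have "\<dots> = (\<Sum>l<n. \<Sum>k<n. Y $$ (k, l) * (A $$ (l, j) * cnj (A $$ (k, i))))"
      using Ac ij by (intro sum.cong) (auto simp: index_mat_adjoint)
    finally show ?thesis .
  qed
  have sw: "(\<Sum>A\<leftarrow>Bs. \<Sum>l<n. \<Sum>k<n. Y $$ (k, l) * (A $$ (l, j) * cnj (A $$ (k, i))))
      = (\<Sum>l<n. \<Sum>k<n. Y $$ (k, l) * (\<Sum>A\<leftarrow>Bs. A $$ (l, j) * cnj (A $$ (k, i))))" for Bs
    by (induction Bs) (simp_all add: sum.distrib distrib_left)
  have "kraus_dual p As Y $$ (i, j) = (\<Sum>A\<leftarrow>As. \<Sum>l<n. \<Sum>k<n. Y $$ (k, l) * (A $$ (l, j) * cnj (A $$ (k, i))))"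
    unfolding kraus_dual_def using ij D by (auto intro!: arg_cong[where f = sum_list])
  also have "\<dots> = (\<Sum>l<n. \<Sum>k<n. Y $$ (k, l) * kraus_map n As ?E $$ (l, k))"
    unfolding sw using S by (intro sum.cong) auto
  finally show ?thesis .
qed

lemma dual_map_eq:
  assumes rep: "kraus_rep p n \<Phi> As" and Y: "Y \<in> carrier_mat n n"
  shows "dual_map p n \<Phi> Y = kraus_dual p As Y"
proof -
  define Bs where "Bs = (SOME As. kraus_rep p n \<Phi> As)"
  have repB: "kraus_rep p n \<Phi> Bs" unfolding Bs_def using rep by (rule someI)
  have eq: "kraus_map n Bs Z = kraus_map n As Z" if "Z \<in> carrier_mat p p" for Z
    using rep repB that unfolding kraus_rep_def by metis
  have "kraus_dual p Bs Y = kraus_dual p As Y"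
  proof (rule eq_matI)
    fix i j assume "i < dim_row (kraus_dual p As Y)" "j < dim_col (kraus_dual p As Y)"
    then have ij: "i < p" "j < p" by (auto simp: kraus_dual_def)
    show "kraus_dual p Bs Y $$ (i, j) = kraus_dual p As Y $$ (i, j)"
      using rep repB Y ij by (simp add: kraus_rep_def kraus_dual_index[of _ n] eq)
  qed (auto simp: kraus_dual_def)
  then show ?thesis unfolding dual_map_def Bs_def .
qed

lemma map_size_complex:
  assumes "completely_positive p n \<Phi>"
  shows "complex_of_real (map_size p \<Phi>) = mat_trace (\<Phi> (1\<^sub>m p))"
proof -
  obtain As where As: "set As \<subseteq> carrier_mat n p" and rep: "\<Phi> (1\<^sub>m p) = kraus_map n As (1\<^sub>m p)"
    using assms unfolding completely_positive_def kraus_rep_def by auto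
  have r: "(A * 1\<^sub>m p * mat_adjoint A) $$ (i, i) \<in> \<real>" if A: "A \<in> set As" and i: "i < n" for A i
  proof -
    have Ac: "A \<in> carrier_mat n p" using As A by auto
    have "(A * 1\<^sub>m p * mat_adjoint A) $$ (i, i) = (\<Sum>k<p. A $$ (i, k) * cnj (A $$ (i, k)))"
      using Ac i by (simp add: scalar_prod_def index_mat_adjoint atLeast0LessThan)
    also have "\<dots> \<in> \<real>" by (intro sum_in_Reals) (simp add: complex_mult_cnj del: of_real_add)
    finally show ?thesis .
  qed
  have sl: "(\<And>x. x \<in> set xs \<Longrightarrow> f x \<in> \<real>) \<Longrightarrow> sum_list (map f xs) \<in> \<real>"
    for f :: "complex mat \<Rightarrow> complex" and xs by (induction xs) auto
  have "mat_trace (\<Phi> (1\<^sub>m p)) \<in> \<real>"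
    unfolding rep mat_trace_def kraus_map_def by (auto intro!: sum_in_Reals sl r)
  then show ?thesis unfolding map_size_def by (simp add: of_real_Re)
qed

lemma kraus_rep_scaling:
  assumes rep: "kraus_rep p n \<Phi> As" and L: "L \<in> carrier_mat p p" and R: "R \<in> carrier_mat n n"
  shows "kraus_rep p n (scaling \<Phi> L R) (map (\<lambda>A. R * A * mat_adjoint L) As)"
  unfolding kraus_rep_def
proof (intro conjI ballI)
  note L' = mat_adjoint_carrier[OF L] and R' = mat_adjoint_carrier[OF R]
  have As: "set As \<subseteq> carrier_mat n p" using rep unfolding kraus_rep_def by auto
  show "set (map (\<lambda>A. R * A * mat_adjoint L) As) \<subseteq> carrier_mat n p" using As L' R by auto
  fix Y :: "complex mat" assume Y: "Y \<in> carrier_mat p p"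
  let ?Z = "mat_adjoint L * Y * L"
  have Z: "?Z \<in> carrier_mat p p" using L L' Y by auto
  have \<Phi>: "\<Phi> ?Z = kraus_map n As ?Z" using rep Z unfolding kraus_rep_def by auto
  have K: "kraus_map n As ?Z \<in> carrier_mat n n" by (simp add: kraus_map_def)
  show "scaling \<Phi> L R Y = kraus_map n (map (\<lambda>A. R * A * mat_adjoint L) As) Y"
  proof (rule eq_matI)
    fix i j assume "i < dim_row (kraus_map n (map (\<lambda>A. R * A * mat_adjoint L) As) Y)"
      "j < dim_col (kraus_map n (map (\<lambda>A. R * A * mat_adjoint L) As) Y)"
    then have ij: "i < n" "j < n" by (auto simp: kraus_map_def)
    have one: "(R * A * mat_adjoint L * Y * mat_adjoint (R * A * mat_adjoint L)) $$ (i, j)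
        = (\<Sum>l<n. \<Sum>k<n. R $$ (i, k) * (A * ?Z * mat_adjoint A) $$ (k, l) * mat_adjoint R $$ (l, j))"
      if "A \<in> set As" for A
    proof -
      have A: "A \<in> carrier_mat n p" using As that by auto
      note A' = mat_adjoint_carrier[OF A]
      have "mat_adjoint (R * A * mat_adjoint L) = L * (mat_adjoint A * mat_adjoint R)"
        using mat_adjoint_mult[of "R * A" n p "mat_adjoint L" p] mat_adjoint_mult[OF R A] A R L'
        by (simp add: mat_adjoint_adjoint del: assoc_mult_mat)
      then have "R * A * mat_adjoint L * Y * mat_adjoint (R * A * mat_adjoint L)
          = R * A * mat_adjoint L * Y * (L * (mat_adjoint A * mat_adjoint R))" by simp
      also have "\<dots> = R * (A * ?Z * mat_adjoint A) * mat_adjoint R"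
        using A A' R R' L L' Y
        by (smt (verit, best) assoc_mult_mat mult_carrier_mat)
      finally show ?thesis
        using index_sandwich[OF R _ R' ij, of "A * ?Z * mat_adjoint A"] A A' Z by simp
    qed
    have sw: "(\<Sum>l<n. \<Sum>k<n. R $$ (i, k) * (\<Sum>A\<leftarrow>Bs. f A k l) * mat_adjoint R $$ (l, j))
        = (\<Sum>A\<leftarrow>Bs. \<Sum>l<n. \<Sum>k<n. R $$ (i, k) * f A k l * mat_adjoint R $$ (l, j))"
      for f :: "complex mat \<Rightarrow> nat \<Rightarrow> nat \<Rightarrow> complex" and Bs
      by (induction Bs) (simp_all add: sum.distrib distrib_left distrib_right)
    have "scaling \<Phi> L R Y $$ (i, j)
        = (\<Sum>l<n. \<Sum>k<n. R $$ (i, k) * kraus_map n As ?Z $$ (k, l) * mat_adjoint R $$ (l, j))"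
      unfolding scaling_def \<Phi> by (rule index_sandwich[OF R K R' ij])
    also have "\<dots> = (\<Sum>l<n. \<Sum>k<n. R $$ (i, k) * (\<Sum>A\<leftarrow>As. (A * ?Z * mat_adjoint A) $$ (k, l)) * mat_adjoint R $$ (l, j))"
      by (intro sum.cong) (auto simp: kraus_map_def)
    also have "\<dots> = (\<Sum>A\<leftarrow>As. (R * A * mat_adjoint L * Y * mat_adjoint (R * A * mat_adjoint L)) $$ (i, j))"
      unfolding sw using one by (auto intro!: arg_cong[where f = sum_list])
    finally show "scaling \<Phi> L R Y $$ (i, j) = kraus_map n (map (\<lambda>A. R * A * mat_adjoint L) As) Y $$ (i, j)"
      using ij by (simp add: kraus_map_def comp_def)
  qed (use R R' in \<open>auto simp: kraus_map_def scaling_def\<close>)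
qed

lemma completely_positive_scaling:
  assumes "completely_positive p n \<Phi>" "L \<in> carrier_mat p p" "R \<in> carrier_mat n n"
  shows "completely_positive p n (scaling \<Phi> L R)"
  using assms kraus_rep_scaling unfolding completely_positive_def by blast

end

theory Submission
  imports Defs "Jordan_Normal_Form.Spectral_Radius" "HOL-Analysis.Convex" "HOL-Analysis.L2_Norm"
    "HOL-Analysis.Function_Topology"
begin

text \<open>
  The factor \<open>L\<close> is the square root of a minimiser \<open>X\<close> of \<open>det (\<Phi> X)\<close> over the Hermitian matrices of
  determinant one in a fixed Frobenius ball around the identity, and \<open>R\<close> is the inverse square root of
  \<open>\<Phi> X\<close>, normalised to determinant one. If \<open>X\<close> is interior, the first-order conditions at \<open>X\<close> are
  exactly double balancedness.

  To locate \<open>X\<close>, write \<open>X = U diag(exp z) U\<^sup>*\<close> and \<open>\<Phi> X = V diag(m) V\<^sup>*\<close>. Then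
  \<open>m k = (\<Sum>l. b k l * exp (z l))\<close>, where \<open>b k l\<close> sums the squared moduli of the \<open>(k, l)\<close> entries of
  \<open>V\<^sup>* A U\<close> over the Kraus operators \<open>A\<close>. The matrix \<open>b\<close> inherits almost constant row and column sums and
  the spectral gap, so the bound on \<open>z\<close> is a statement about scaling a nonnegative matrix: moving from
  \<open>0\<close> to \<open>z\<close> changes the objective by a linear term of order \<open>\<epsilon>\<close> plus a quadratic term of order \<open>\<lambda>\<close>.
  The quadratic term keeps its order \<open>\<lambda>\<close> throughout a ball of constant radius, which is why smallness of
  \<open>\<epsilon> sqrt p / \<lambda>\<close>, rather than of \<open>\<epsilon> sqrt p / \<lambda>\<^sup>2\<close>, is enough.
\<close>

unbundle no inner_syntax

section \<open>Scaling exponents of nonnegative matrices\<close>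

text \<open>The quantity being minimised is Gurvits' capacity, the infimum of det (\<Phi> X) over
  positive X of determinant one, restricted to a ball. The ball reduces existence of a minimiser to
  compactness, but first-order conditions hold only off its boundary, so an a priori estimate has to
  push the minimiser strictly inside. That estimate compares just two points, X and the identity:
  det (\<Phi> X) \<le> det (\<Phi> 1) \<le> (s/n)^n, the second inequality being AM-GM. The bases U
  and V depend on the unknown X, which is harmless because balance and the spectral gap pass to the
  weights in every pair of unitary bases.

  The two conclusions are in different norms because z is controlled in l2, whereas \<Phi> X is
  controlled only eigenvalue by eigenvalue. Constants: 12 comes from the quadratic inequality, a
  factor 2 from passing from ln x to x - 1, a factor 8 from the ratio of eigenvalues, and 12 * 2 * 8
  = 192 \<le> 200. The threshold 1/100 puts the minimiser within 24/100 of the identity, less than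
  the radius 1/3 of the ball.\<close>

lemma exp_ge_quadratic:
  fixes x :: real
  assumes "-2 \<le> x"
  shows "1 + x + x\<^sup>2 / 4 \<le> exp x"
proof -
  \<comment> \<open>The coefficient 1/4, half of the Taylor coefficient, makes the left side a
    perfect square; the lower bound on \<open>x\<close> keeps its base nonnegative.\<close>
  have "1 + x + x\<^sup>2 / 4 = (1 + x / 2)\<^sup>2" by (simp add: power2_eq_square field_simps)
  also have "\<dots> \<le> (exp (x / 2))\<^sup>2"
    using exp_ge_add_one_self[of "x / 2"] assms by (intro power_mono) auto
  also have "\<dots> = exp x" by (simp add: power2_eq_square flip: exp_add)
  finally show ?thesis .
qed

lemma abs_sum_mult_le_sqrt:
  fixes f g :: "'a \<Rightarrow> real"
  shows "\<bar>\<Sum>i\<in>I. f i * g i\<bar> \<le> sqrt (\<Sum>i\<in>I. (f i)\<^sup>2) * sqrt (\<Sum>i\<in>I. (g i)\<^sup>2)"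
proof -
  have "\<bar>\<Sum>i\<in>I. f i * g i\<bar> \<le> (\<Sum>i\<in>I. \<bar>f i\<bar> * \<bar>g i\<bar>)"
    by (rule order_trans[OF sum_abs]) (simp add: abs_mult)
  also have "\<dots> \<le> L2_set f I * L2_set g I" by (rule L2_set_mult_ineq)
  finally show ?thesis by (simp add: L2_set_def)
qed

text \<open>Cauchy-Schwarz, with the l2 norm of \<open>d\<close> bounded by
  \<open>e * sqrt n\<close>. It serves for the linear terms, where \<open>d\<close> is the deviation
  of row or column sums from their mean.\<close>

lemma sum_mult_ge_of_bounded:
  fixes d x :: "nat \<Rightarrow> real"
  assumes "\<And>i. i < n \<Longrightarrow> \<bar>d i\<bar> \<le> e" "0 \<le> e"
  shows "- (e * (sqrt n * sqrt (\<Sum>i<n. (x i)\<^sup>2))) \<le> (\<Sum>i<n. d i * x i)"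
proof -
  have "sqrt (\<Sum>i<n. (d i)\<^sup>2) \<le> sqrt (\<Sum>i<n. e\<^sup>2)"
    using assms by (intro real_sqrt_le_mono sum_mono) (metis abs_le_square_iff abs_of_nonneg lessThan_iff)
  also have "\<dots> = e * sqrt n" using assms(2) by (simp add: real_sqrt_mult)
  finally have "sqrt (\<Sum>i<n. (d i)\<^sup>2) * sqrt (\<Sum>i<n. (x i)\<^sup>2) \<le> e * sqrt n * sqrt (\<Sum>i<n. (x i)\<^sup>2)"
    by (intro mult_right_mono) (auto intro: sum_nonneg)
  with abs_sum_mult_le_sqrt[of d x "{..<n}"] show ?thesis by (simp add: mult.assoc)
qed

lemma sum_sqr_ge_of_bounded:
  fixes d x :: "nat \<Rightarrow> real"
  assumes "\<And>i. i < n \<Longrightarrow> e \<le> d i"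
  shows "e * (sqrt (\<Sum>i<n. (x i)\<^sup>2))\<^sup>2 \<le> (\<Sum>i<n. d i * (x i)\<^sup>2)"
proof -
  have "e * (sqrt (\<Sum>i<n. (x i)\<^sup>2))\<^sup>2 = (\<Sum>i<n. e * (x i)\<^sup>2)"
    by (simp add: sum_nonneg sum_distrib_left)
  also have "\<dots> \<le> (\<Sum>i<n. d i * (x i)\<^sup>2)"
    using assms by (intro sum_mono mult_right_mono) auto
  finally show ?thesis .
qed

text \<open>Since \<epsilon> is at most lam/2, the form dominates lam/2 times the sum of squares.
  With a = 8 * \<epsilon> / lam the hypothesis becomes \<zeta>^2 + \<omega>^2 \<le> a * (\<zeta> +
  \<omega>). Completing the square in \<omega> leaves \<zeta> * (\<zeta> - a) \<le> a^2 / 4, which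
  fails once \<zeta> exceeds 3a/2 = 12 * \<epsilon> / lam.\<close>

lemma quadratic_form_bound:
  fixes \<zeta> \<omega> \<epsilon> lam :: real
  assumes "0 \<le> \<epsilon>" "0 < lam" "\<epsilon> \<le> lam / 2" "lam \<le> 1"
    and q: "((1 - \<epsilon>) * \<zeta>\<^sup>2 + (1 - \<epsilon>) * \<omega>\<^sup>2 - 2 * ((1 - lam) * \<zeta> * \<omega>)) / 4 \<le> \<epsilon> * \<zeta> + \<epsilon> * \<omega>"
  shows "\<zeta> \<le> 12 * (\<epsilon> / lam)"
proof (rule ccontr)
  define a where "a = 8 * \<epsilon> / lam"
  assume "\<not> \<zeta> \<le> 12 * (\<epsilon> / lam)"
  then have big: "3 * a / 2 < \<zeta>" unfolding a_def by simp
  have a0: "0 \<le> a" unfolding a_def using assms by simp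
  have "0 \<le> (1 - lam) * (\<zeta> - \<omega>)\<^sup>2" using assms by simp
  moreover have "0 \<le> (lam / 2 - \<epsilon>) * (\<zeta>\<^sup>2 + \<omega>\<^sup>2)" using assms by simp
  moreover have "(1 - \<epsilon>) * \<zeta>\<^sup>2 + (1 - \<epsilon>) * \<omega>\<^sup>2 - 2 * ((1 - lam) * \<zeta> * \<omega>)
      = (1 - lam) * (\<zeta> - \<omega>)\<^sup>2 + (lam / 2 - \<epsilon>) * (\<zeta>\<^sup>2 + \<omega>\<^sup>2) + lam / 2 * (\<zeta>\<^sup>2 + \<omega>\<^sup>2)"
    by (simp add: power2_eq_square algebra_simps)
  ultimately have "lam / 8 * (\<zeta>\<^sup>2 + \<omega>\<^sup>2) \<le> \<epsilon> * \<zeta> + \<epsilon> * \<omega>" using q by simp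
  also have "\<dots> = lam / 8 * (a * (\<zeta> + \<omega>))" unfolding a_def using assms by (simp add: field_simps)
  finally have "\<zeta>\<^sup>2 + \<omega>\<^sup>2 \<le> a * (\<zeta> + \<omega>)" using assms(2) by simp
  moreover have "0 \<le> (\<omega> - a / 2)\<^sup>2" by simp
  ultimately have "\<zeta> * (\<zeta> - a) \<le> a\<^sup>2 / 4" by (simp add: power2_eq_square algebra_simps)
  moreover have "(3 * a / 2) * (a / 2) \<le> \<zeta> * (\<zeta> - a)" using big a0 by (intro mult_mono) auto
  ultimately have "a * a \<le> 0" by (simp add: power2_eq_square)
  then have "a = 0" using mult_eq_0_iff[of a a] zero_le_square[of a] by linarith
  then have "\<zeta> * \<zeta> \<le> 0" "0 < \<zeta>" using \<open>\<zeta> * (\<zeta> - a) \<le> a\<^sup>2 / 4\<close> big by simp_all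
  then show False using leD mult_pos_pos by blast
qed

text \<open>Choosing \<open>w\<close> so that all rows of \<open>b k l * exp (z l + w k)\<close> have sum \<open>s / n\<close>, the bound on the
  product says \<open>sum w \<ge> 0\<close>. The total weight is then \<open>s\<close>, while expanding the exponential to second
  order bounds it from below by \<open>s\<close>, a linear term of order \<open>\<epsilon>\<close>, and a quadratic form of order \<open>lam\<close>.\<close>

lemma scaling_exponents_small:
  fixes b :: "nat \<Rightarrow> nat \<Rightarrow> real" and z :: "nat \<Rightarrow> real" and s \<epsilon> lam :: real
  assumes p: "1 \<le> p" and n: "1 \<le> n" and s: "0 < s" and e0: "0 \<le> \<epsilon>" and el: "\<epsilon> \<le> lam / 2"
    and l0: "0 < lam" and l1: "lam \<le> 1"
    and b0: "\<And>k l. 0 \<le> b k l"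
    and tot: "(\<Sum>k<n. \<Sum>l<p. b k l) = s"
    and row: "\<And>k. k < n \<Longrightarrow> \<bar>(\<Sum>l<p. b k l) - s / n\<bar> \<le> s * \<epsilon> / n"
    and col: "\<And>l. l < p \<Longrightarrow> \<bar>(\<Sum>k<n. b k l) - s / p\<bar> \<le> s * \<epsilon> / p"
    and gap: "sqrt (\<Sum>k<n. (\<Sum>l<p. b k l * z l)\<^sup>2)
      \<le> (1 - lam) * (s / sqrt (real n * real p)) * sqrt (\<Sum>l<p. (z l)\<^sup>2)"
    and z0: "(\<Sum>l<p. z l) = 0" and z1: "\<And>l. l < p \<Longrightarrow> \<bar>z l\<bar> \<le> 1 / 2"
    and prod: "(\<Prod>k<n. \<Sum>l<p. b k l * exp (z l)) \<le> (s / n) ^ n"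
  shows "sqrt (\<Sum>l<p. (z l)\<^sup>2) \<le> 12 * (\<epsilon> * sqrt p / lam)"
proof -
  define r where "r k = (\<Sum>l<p. b k l)" for k
  define c where "c l = (\<Sum>k<n. b k l)" for l
  define m where "m k = (\<Sum>l<p. b k l * exp (z l))" for k
  define w where "w k = - ln (n * m k / s)" for k
  define Z where "Z = sqrt (\<Sum>l<p. (z l)\<^sup>2)"
  define W where "W = sqrt (\<Sum>k<n. (w k)\<^sup>2)"
  \<comment> \<open>Root mean squares: in these units the factors p, n and sqrt (n p) cancel, and
    each of the estimates \<open>t1\<close> to \<open>t5\<close> is s times an expression in \<zeta>
    and \<omega>.\<close>
  define \<zeta> where "\<zeta> = Z / sqrt p"
  define \<omega> where "\<omega> = W / sqrt n"
  have e1: "\<epsilon> \<le> 1 / 2" using el l1 by simp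
  have np: "0 < real n" "0 < real p" using n p by auto
  have r1: "s / n * (1 - \<epsilon>) \<le> r k" "r k \<le> s / n * (1 + \<epsilon>)" if "k < n" for k
    using row[OF that] np unfolding r_def by (auto simp: abs_le_iff field_simps)
  have c1: "s / p * (1 - \<epsilon>) \<le> c l" if "l < p" for l
    using col[OF that] np unfolding c_def by (auto simp: abs_le_iff field_simps)
  have r0: "0 < r k" if "k < n" for k
  proof -
    have "0 < s / n * (1 - \<epsilon>)" using s np e1 by simp
    then show ?thesis using r1(1)[OF that] by linarith
  qed
  have m0: "0 < m k" if "k < n" for k
  proof -
    have "b k l * exp (- (1/2)) \<le> b k l * exp (z l)" if "l < p" for l
      using z1[OF that] b0 by (intro mult_left_mono) (auto simp: abs_le_iff)
    then have "exp (- (1/2)) * r k \<le> m k"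
      unfolding r_def m_def sum_distrib_left by (intro sum_mono) (simp add: mult.commute)
    then show ?thesis using r0[OF that] by (smt (verit) exp_gt_zero mult_pos_pos)
  qed
  \<comment> \<open>A lower bound is enough, because \<open>exp_ge_quadratic\<close> is one-sided:
    with z at least -1/2 the exponent z + w stays above -2, however large w is. The exponent 1
    splits into 1/2 from z and 1/2 from 1 + \<epsilon> \<le> exp (1/2).\<close>
  have wb: "- 1 \<le> w k" if "k < n" for k
  proof -
    have "b k l * exp (z l) \<le> b k l * exp (1/2)" if "l < p" for l
      using z1[OF that] b0 by (intro mult_left_mono) (auto simp: abs_le_iff)
    then have "m k \<le> exp (1/2) * r k"
      unfolding r_def m_def sum_distrib_left by (intro sum_mono) (simp add: mult.commute)
    also have "\<dots> \<le> exp (1/2) * (s / n * (1 + \<epsilon>))" using r1(2)[OF that] by (intro mult_left_mono) auto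
    also have "\<dots> \<le> exp (1/2) * (s / n * exp (1/2))"
      using s np e1 exp_ge_add_one_self[of "1/2"] by (intro mult_left_mono) auto
    also have "\<dots> = s / n * exp 1" by (simp flip: exp_add)
    finally have "n * m k / s \<le> exp 1" using s np by (simp add: field_simps)
    then have "ln (n * m k / s) \<le> ln (exp 1)"
      using m0[OF that] s np by (intro ln_mono) auto
    then show ?thesis unfolding w_def by simp
  qed
  have we: "exp (w k) * m k = s / n" if "k < n" for k
    using m0[OF that] s np unfolding w_def by (simp add: exp_minus exp_ln field_simps)
  have wsum: "0 \<le> (\<Sum>k<n. w k)"
  proof -
    have pos: "0 < n * m k / s" if "k < n" for k using m0[OF that] s np by simp
    have "ln (\<Prod>k<n. n * m k / s) = (\<Sum>k<n. ln (n * m k / s))"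
      by (rule ln_prod) (use pos in force)+
    then have "(\<Sum>k<n. w k) = - ln (\<Prod>k<n. n * m k / s)"
      unfolding w_def by (simp add: sum_negf)
    also have "(\<Prod>k<n. n * m k / s) = (n / s) ^ n * (\<Prod>k<n. m k)"
      by (simp add: prod.distrib power_divide prod_dividef)
    also have "- ln ((n / s) ^ n * (\<Prod>k<n. m k)) \<ge> 0"
    proof -
      have "(n / s) ^ n * (\<Prod>k<n. m k) \<le> (n / s) ^ n * (s / n) ^ n"
        using prod s unfolding m_def by (intro mult_left_mono) auto
      also have "\<dots> = 1" using s np by (simp flip: power_mult_distrib)
      finally have "(n / s) ^ n * (\<Prod>k<n. m k) \<le> 1" .
      moreover have "0 < (n / s) ^ n * (\<Prod>k<n. m k)" using m0 s np by (auto intro!: mult_pos_pos prod_pos)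
      ultimately show ?thesis by simp
    qed
    finally show ?thesis .
  qed
  have tot2: "(\<Sum>k<n. \<Sum>l<p. b k l * exp (z l + w k)) = s"
  proof -
    have "(\<Sum>l<p. b k l * exp (z l + w k)) = s / n" if "k < n" for k
      unfolding we[OF that, symmetric] m_def sum_distrib_left by (simp add: exp_add mult_ac)
    then have "(\<Sum>k<n. \<Sum>l<p. b k l * exp (z l + w k)) = (\<Sum>k<n. s / n)" by (intro sum.cong) auto
    then show ?thesis using np by simp
  qed
  have expand: "(\<Sum>k<n. \<Sum>l<p. b k l * (1 + (z l + w k) + (z l + w k)\<^sup>2 / 4)) \<le> s"
    unfolding tot2[symmetric]
  proof (intro sum_mono mult_left_mono exp_ge_quadratic b0)
    fix k l assume "k \<in> {..<n}" "l \<in> {..<p}"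
    then show "- 2 \<le> z l + w k" using wb[of k] z1[of l] by (auto simp: abs_le_iff)
  qed
  have split: "b k l * (1 + (z l + w k) + (z l + w k)\<^sup>2 / 4)
     = b k l + b k l * z l + b k l * w k + (b k l * (z l)\<^sup>2 + b k l * (w k)\<^sup>2 + 2 * (b k l * z l * w k)) / 4" for k l
    by (simp add: power2_eq_square field_simps)
  have sw: "(\<Sum>k<n. \<Sum>l<p. b k l * f l) = (\<Sum>l<p. c l * f l)" for f
    unfolding c_def sum_distrib_right by (rule sum.swap)
  have sr: "(\<Sum>k<n. \<Sum>l<p. b k l * f k) = (\<Sum>k<n. r k * f k)" for f
    unfolding r_def sum_distrib_right ..
  have "(\<Sum>k<n. \<Sum>l<p. b k l * (1 + (z l + w k) + (z l + w k)\<^sup>2 / 4))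
     = s + (\<Sum>l<p. c l * z l) + (\<Sum>k<n. r k * w k)
      + ((\<Sum>l<p. c l * (z l)\<^sup>2) + (\<Sum>k<n. r k * (w k)\<^sup>2)
         + 2 * (\<Sum>k<n. (\<Sum>l<p. b k l * z l) * w k)) / 4"
    unfolding split by (simp add: sum.distrib sum_divide_distrib[symmetric] tot sw sr
        sum_distrib_left[symmetric] sum_distrib_right[symmetric] r_def)
  with expand have main: "(\<Sum>l<p. c l * z l) + (\<Sum>k<n. r k * w k)
      + ((\<Sum>l<p. c l * (z l)\<^sup>2) + (\<Sum>k<n. r k * (w k)\<^sup>2)
         + 2 * (\<Sum>k<n. (\<Sum>l<p. b k l * z l) * w k)) / 4 \<le> 0" by simp
  have nn: "0 \<le> Z" "0 \<le> W" unfolding Z_def W_def by (auto intro: sum_nonneg)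
  have Zz: "Z = sqrt p * \<zeta>" and Ww: "W = sqrt n * \<omega>"
    unfolding \<zeta>_def \<omega>_def using np by auto
  have sqrt_sqrt_mult: "sqrt (real i) * (sqrt (real i) * x) = i * x" for i x
    by (simp flip: mult.assoc)
  have t1: "- (s * (\<epsilon> * \<zeta>)) \<le> (\<Sum>l<p. c l * z l)"
  proof -
    have "(\<Sum>l<p. (c l - s / p) * z l) = (\<Sum>l<p. c l * z l) - s / p * (\<Sum>l<p. z l)"
      by (simp add: left_diff_distrib sum_subtractf sum_distrib_left)
    then have "(\<Sum>l<p. c l * z l) = (\<Sum>l<p. (c l - s / p) * z l)" using z0 by simp
    moreover have "- (s * \<epsilon> / p * (sqrt p * Z)) \<le> (\<Sum>l<p. (c l - s / p) * z l)"
      unfolding Z_def using col s e0 np unfolding c_def by (intro sum_mult_ge_of_bounded) auto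
    moreover have "s * \<epsilon> / p * (sqrt p * Z) = s * (\<epsilon> * \<zeta>)" unfolding Zz sqrt_sqrt_mult using np by simp
    ultimately show ?thesis by simp
  qed
  have t2: "- (s * (\<epsilon> * \<omega>)) \<le> (\<Sum>k<n. r k * w k)"
  proof -
    have "(\<Sum>k<n. r k * w k) = (\<Sum>k<n. (r k - s / n) * w k) + s / n * (\<Sum>k<n. w k)"
      by (simp add: left_diff_distrib sum_subtractf sum_distrib_left)
    moreover have "0 \<le> s / n * (\<Sum>k<n. w k)" using wsum s by simp
    moreover have "- (s * \<epsilon> / n * (sqrt n * W)) \<le> (\<Sum>k<n. (r k - s / n) * w k)"
      unfolding W_def using row s e0 np unfolding r_def by (intro sum_mult_ge_of_bounded) auto
    moreover have "s * \<epsilon> / n * (sqrt n * W) = s * (\<epsilon> * \<omega>)" unfolding Ww sqrt_sqrt_mult using np by simp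
    ultimately show ?thesis by linarith
  qed
  have t3: "s * ((1 - \<epsilon>) * \<zeta>\<^sup>2) \<le> (\<Sum>l<p. c l * (z l)\<^sup>2)"
  proof -
    have "s / p * (1 - \<epsilon>) * Z\<^sup>2 \<le> (\<Sum>l<p. c l * (z l)\<^sup>2)"
      unfolding Z_def by (rule sum_sqr_ge_of_bounded) (rule c1)
    moreover have "s / p * (1 - \<epsilon>) * Z\<^sup>2 = s * ((1 - \<epsilon>) * \<zeta>\<^sup>2)"
      unfolding Zz using np by (simp add: power_mult_distrib)
    ultimately show ?thesis by simp
  qed
  have t4: "s * ((1 - \<epsilon>) * \<omega>\<^sup>2) \<le> (\<Sum>k<n. r k * (w k)\<^sup>2)"
  proof -
    have "s / n * (1 - \<epsilon>) * W\<^sup>2 \<le> (\<Sum>k<n. r k * (w k)\<^sup>2)"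
      unfolding W_def by (rule sum_sqr_ge_of_bounded) (rule r1)
    moreover have "s / n * (1 - \<epsilon>) * W\<^sup>2 = s * ((1 - \<epsilon>) * \<omega>\<^sup>2)"
      unfolding Ww using np by (simp add: power_mult_distrib)
    ultimately show ?thesis by simp
  qed
  \<comment> \<open>The only place where the spectral gap enters: the cross term pairs the image of
    z with w.\<close>
  have t5: "- (s * ((1 - lam) * \<zeta> * \<omega>)) \<le> (\<Sum>k<n. (\<Sum>l<p. b k l * z l) * w k)"
  proof -
    have "\<bar>\<Sum>k<n. (\<Sum>l<p. b k l * z l) * w k\<bar> \<le> sqrt (\<Sum>k<n. (\<Sum>l<p. b k l * z l)\<^sup>2) * W"
      unfolding W_def by (rule abs_sum_mult_le_sqrt)
    also have "\<dots> \<le> (1 - lam) * (s / sqrt (real n * real p)) * Z * W"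
      using gap nn unfolding Z_def by (intro mult_right_mono) auto
    also have "\<dots> = s * ((1 - lam) * \<zeta> * \<omega>)"
      unfolding Zz Ww using np by (simp add: real_sqrt_mult)
    finally show ?thesis by simp
  qed
  have "s * (((1 - \<epsilon>) * \<zeta>\<^sup>2 + (1 - \<epsilon>) * \<omega>\<^sup>2 - 2 * ((1 - lam) * \<zeta> * \<omega>)) / 4) \<le> s * (\<epsilon> * \<zeta> + \<epsilon> * \<omega>)"
  proof -
    have "s * (((1 - \<epsilon>) * \<zeta>\<^sup>2 + (1 - \<epsilon>) * \<omega>\<^sup>2 - 2 * ((1 - lam) * \<zeta> * \<omega>)) / 4)
      = (s * ((1 - \<epsilon>) * \<zeta>\<^sup>2) + s * ((1 - \<epsilon>) * \<omega>\<^sup>2) + 2 * - (s * ((1 - lam) * \<zeta> * \<omega>))) / 4"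
      by (simp add: right_diff_distrib distrib_left)
    moreover have "g \<le> a1 + a2"
      if "T1 + T2 + (T3 + T4 + 2 * T5) / 4 \<le> 0" "- a1 \<le> T1" "- a2 \<le> T2" "a3 \<le> T3" "a4 \<le> T4"
        "- a5 \<le> T5" "g = (a3 + a4 + 2 * - a5) / 4" for g a1 a2 a3 a4 a5 T1 T2 T3 T4 T5 :: real
      unfolding that(7) using that(1-6) by (simp add: field_simps)
    ultimately show ?thesis using main t1 t2 t3 t4 t5 unfolding distrib_left[of s "\<epsilon> * \<zeta>"] by blast
  qed
  then have "((1 - \<epsilon>) * \<zeta>\<^sup>2 + (1 - \<epsilon>) * \<omega>\<^sup>2 - 2 * ((1 - lam) * \<zeta> * \<omega>)) / 4 \<le> \<epsilon> * \<zeta> + \<epsilon> * \<omega>"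
    using s by (rule mult_left_le_imp_le)
  then have "\<zeta> \<le> 12 * (\<epsilon> / lam)" by (rule quadratic_form_bound[OF e0 l0 el l1])
  \<comment> \<open>The factor sqrt p of the theorem arises here, in returning from the root mean
    square to the l2 norm.\<close>
  then have "sqrt p * \<zeta> \<le> sqrt p * (12 * (\<epsilon> / lam))" by (rule mult_left_mono) simp
  then show ?thesis unfolding Zz[symmetric] Z_def[symmetric] by (simp add: mult_ac)
qed

section \<open>Unitary diagonalisation\<close>

lemma mat_mult_assoc_dim:
  fixes A :: "'a :: semiring_0 mat"
  assumes "dim_col A = dim_row B" "dim_col B = dim_row C"
  shows "A * B * C = A * (B * C)"
  using assms by (intro assoc_mult_mat[of A "dim_row A" "dim_row B" B "dim_row C" C "dim_col C"]) auto

lemma mat_trace_mult_commute: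
  assumes "A \<in> carrier_mat n m" "B \<in> carrier_mat m n"
  shows "mat_trace (A * B) = mat_trace (B * A)"
proof -
  have "mat_trace (A * B) = (\<Sum>i<n. \<Sum>j<m. A $$ (i, j) * B $$ (j, i))"
    using assms by (simp add: mat_trace_def scalar_prod_def atLeast0LessThan)
  also have "\<dots> = (\<Sum>j<m. \<Sum>i<n. A $$ (i, j) * B $$ (j, i))"
    by (rule sum.swap)
  also have "\<dots> = mat_trace (B * A)"
    using assms by (simp add: mat_trace_def scalar_prod_def atLeast0LessThan mult.commute)
  finally show ?thesis .
qed

lemma frob_norm_square: "(frob_norm A)\<^sup>2 = (\<Sum>i<dim_row A. \<Sum>j<dim_col A. (cmod (A $$ (i, j)))\<^sup>2)"
  unfolding frob_norm_def by (intro real_sqrt_pow2 sum_nonneg) auto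

lemma frob_norm_nonneg: "0 \<le> frob_norm A"
  unfolding frob_norm_def by (intro real_sqrt_ge_zero sum_nonneg) auto

lemma frob_norm_square_trace:
  "complex_of_real ((frob_norm A)\<^sup>2) = mat_trace (mat_adjoint A * A)"
proof -
  have "mat_trace (mat_adjoint A * A)
      = (\<Sum>j<dim_col A. \<Sum>i<dim_row A. cnj (A $$ (i, j)) * A $$ (i, j))"
    by (simp add: mat_trace_def scalar_prod_def atLeast0LessThan index_mat_adjoint)
  also have "\<dots> = (\<Sum>i<dim_row A. \<Sum>j<dim_col A. cnj (A $$ (i, j)) * A $$ (i, j))"
    by (rule sum.swap)
  also have "\<dots> = complex_of_real ((frob_norm A)\<^sup>2)"
    unfolding frob_norm_square by (simp only: of_real_sum complex_norm_square mult.commute)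
  finally show ?thesis by simp
qed

lemma l2_norm_vec_square: "(l2_norm_vec v)\<^sup>2 = (\<Sum>i<dim_vec v. (cmod (v $ i))\<^sup>2)"
  unfolding l2_norm_vec_def by (intro real_sqrt_pow2 sum_nonneg) auto

lemma l2_norm_vec_nonneg: "0 \<le> l2_norm_vec v"
  unfolding l2_norm_vec_def by (intro real_sqrt_ge_zero sum_nonneg) auto

lemma mat_adjoint_one: "mat_adjoint (1\<^sub>m n) = (1\<^sub>m n :: complex mat)"
  by (rule eq_matI) (auto simp: index_mat_adjoint)

lemma det_mat_adjoint:
  assumes A: "A \<in> carrier_mat n n"
  shows "det (mat_adjoint A) = cnj (det A)"
proof -
  have "det (mat_adjoint A) = det (map_mat cnj (transpose_mat A))"
    by (rule arg_cong[of _ _ det], rule eq_matI) (use A in \<open>auto simp: index_mat_adjoint\<close>)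
  also have "\<dots> = cnj (det (transpose_mat A))"
  proof -
    have "comm_ring_hom cnj" by unfold_locales auto
    then show ?thesis using comm_ring_hom.hom_det by (metis)
  qed
  finally show ?thesis using det_transpose[OF A] by simp
qed

definition unitary_mat :: "nat \<Rightarrow> complex mat \<Rightarrow> bool" where
  "unitary_mat n U \<longleftrightarrow> U \<in> carrier_mat n n \<and> mat_adjoint U * U = 1\<^sub>m n \<and> U * mat_adjoint U = 1\<^sub>m n"

lemma unitary_matD:
  assumes "unitary_mat n U"
  shows "U \<in> carrier_mat n n" "mat_adjoint U \<in> carrier_mat n n"
    "mat_adjoint U * U = 1\<^sub>m n" "U * mat_adjoint U = 1\<^sub>m n"
  using assms unfolding unitary_mat_def by (auto intro: mat_adjoint_carrier)

lemma unitary_matI: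
  assumes U: "U \<in> carrier_mat n n" and "mat_adjoint U * U = 1\<^sub>m n"
  shows "unitary_mat n U"
  using assms mat_mult_left_right_inverse[OF mat_adjoint_carrier[OF U] U]
  unfolding unitary_mat_def by simp

lemma unitary_mat_adjoint: "unitary_mat n U \<Longrightarrow> unitary_mat n (mat_adjoint U)"
  unfolding unitary_mat_def by (auto simp: mat_adjoint_adjoint intro: mat_adjoint_carrier)

lemma unitary_mat_one: "unitary_mat n (1\<^sub>m n)"
  by (rule unitary_matI) (auto simp: mat_adjoint_one)

lemma unitary_mat_mult:
  assumes U: "unitary_mat n U" and V: "unitary_mat n V"
  shows "unitary_mat n (U * V)"
proof (rule unitary_matI)
  note u = unitary_matD[OF U] and v = unitary_matD[OF V]
  show "U * V \<in> carrier_mat n n" using u v by auto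
  have "mat_adjoint (U * V) * (U * V) = mat_adjoint V * (mat_adjoint U * U) * V"
    unfolding mat_adjoint_mult[OF u(1) v(1)]
    using carrier_matD[OF u(1)] carrier_matD[OF v(1)] by (simp add: mat_mult_assoc_dim del: assoc_mult_mat)
  then show "mat_adjoint (U * V) * (U * V) = 1\<^sub>m n" using u v by simp
qed

lemma unitary_mult_cancel:
  assumes U: "unitary_mat n U" and M: "dim_row M = n"
  shows "mat_adjoint U * (U * M) = M" "U * (mat_adjoint U * M) = M"
proof -
  note u = unitary_matD[OF U]
  have "mat_adjoint U * (U * M) = (mat_adjoint U * U) * M" "U * (mat_adjoint U * M) = (U * mat_adjoint U) * M"
    using carrier_matD[OF u(1)] M by (simp_all add: mat_mult_assoc_dim del: assoc_mult_mat)
  then show "mat_adjoint U * (U * M) = M" "U * (mat_adjoint U * M) = M"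
    unfolding u using M by auto
qed

lemma unitary_sandwich_cancel:
  assumes U: "unitary_mat n U" and M: "M \<in> carrier_mat n n"
  shows "mat_adjoint U * (U * M * mat_adjoint U) * U = M"
    "U * (mat_adjoint U * M * U) * mat_adjoint U = M"
proof -
  have 1: "mat_adjoint U * (U * M * mat_adjoint U) * U = M" if U: "unitary_mat n U" for U
  proof -
    note u = unitary_matD[OF U]
    have "mat_adjoint U * (U * M * mat_adjoint U) * U = mat_adjoint U * (U * (M * (mat_adjoint U * U)))"
      using carrier_matD[OF u(1)] M by (simp add: mat_mult_assoc_dim del: assoc_mult_mat)
    also have "\<dots> = M" unfolding u(3) using M by (simp add: unitary_mult_cancel[OF U])
    finally show ?thesis .
  qed
  show "mat_adjoint U * (U * M * mat_adjoint U) * U = M" by (rule 1[OF U])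
  show "U * (mat_adjoint U * M * U) * mat_adjoint U = M"
    using 1[OF unitary_mat_adjoint[OF U]] by (simp add: mat_adjoint_adjoint)
qed

lemma sandwich_sandwich:
  fixes P Q D :: "complex mat"
  assumes "P \<in> carrier_mat a b" "Q \<in> carrier_mat b c" "D \<in> carrier_mat c c"
  shows "P * (Q * D * mat_adjoint Q) * mat_adjoint P = (P * Q) * D * mat_adjoint (P * Q)"
  unfolding mat_adjoint_mult[OF assms(1,2)]
  using carrier_matD[OF assms(1)] carrier_matD[OF assms(2)] carrier_matD[OF assms(3)]
  by (simp add: mat_mult_assoc_dim del: assoc_mult_mat)

lemma mat_adjoint_sandwich:
  assumes "P \<in> carrier_mat a b" "M \<in> carrier_mat b c" "Q \<in> carrier_mat c d"
  shows "mat_adjoint (P * M * Q) = mat_adjoint Q * mat_adjoint M * mat_adjoint (P :: complex mat)"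
proof -
  have "mat_adjoint (P * M * Q) = mat_adjoint Q * mat_adjoint (P * M)"
    by (rule mat_adjoint_mult) (use assms in auto)
  also have "\<dots> = mat_adjoint Q * (mat_adjoint M * mat_adjoint P)"
    by (simp add: mat_adjoint_mult[OF assms(1,2)])
  also have "\<dots> = mat_adjoint Q * mat_adjoint M * mat_adjoint P"
    by (rule assoc_mult_mat[symmetric]) (use assms in \<open>auto intro: mat_adjoint_carrier\<close>)
  finally show ?thesis .
qed

lemma hermitian_sandwich:
  assumes P: "P \<in> carrier_mat m n" and M: "M \<in> carrier_mat n n" "hermitian_mat M"
  shows "hermitian_mat (P * M * mat_adjoint P)"
  using mat_adjoint_sandwich[OF P M(1) mat_adjoint_carrier[OF P]] M(2)
  unfolding hermitian_mat_def by (simp add: mat_adjoint_adjoint)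

section \<open>Spectral theorem for Hermitian matrices\<close>

lemma exists_unitary_first_col:
  fixes v :: "complex vec"
  assumes v: "v \<in> carrier_vec n" "v \<noteq> 0\<^sub>v n"
  shows "\<exists>U \<alpha>. unitary_mat n U \<and> col U 0 = \<alpha> \<cdot>\<^sub>v v"
proof -
  interpret cof_vec_space n "TYPE(complex)" .
  have n: "n \<noteq> 0"
  proof
    assume "n = 0"
    then have "v = 0\<^sub>v n" using carrier_vecD[OF v(1)] by (intro eq_vecI) simp_all
    then show False using v(2) by simp
  qed
  define bs where "bs = basis_completion v"
  define ws where "ws = gram_schmidt n bs"
  from basis_completion[OF v, folded bs_def]
  have dist_b: "distinct bs" and indep: "\<not> lin_dep (set bs)" and b: "set bs \<subseteq> carrier_vec n"
    and hdb: "hd bs = v" and len_b: "length bs = n" by auto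
  from hdb len_b n obtain vs where bv: "bs = v # vs" by (cases bs) auto
  from gram_schmidt_result[OF b dist_b indep refl, folded ws_def]
  have ws: "set ws \<subseteq> carrier_vec n" "corthogonal ws" "length ws = n" by (auto simp: len_b)
  from gram_schmidt_hd[OF v(1), of vs, folded bv] have hdws: "hd ws = v" unfolding ws_def .
  have wsc: "ws ! j \<in> carrier_vec n" if "j < n" for j
    using subsetD[OF ws(1) nth_mem, of j] ws(3) that by simp
  \<comment> \<open>\<open>gram_schmidt\<close> keeps the head \<open>v\<close> and returns
    orthogonal vectors of arbitrary length; dividing by the lengths yields a unitary matrix whose
    first column is a multiple of \<open>v\<close>.\<close>
  define N where "N j = complex_of_real (l2_norm_vec (ws ! j))" for j
  define U where "U = mat n n (\<lambda>(i, j). ws ! j $ i / N j)"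
  have U: "U \<in> carrier_mat n n" unfolding U_def by simp
  have prod: "(\<Sum>k<n. cnj (ws ! i $ k) * (ws ! j $ k)) = ws ! j \<bullet>c ws ! i" if "i < n" "j < n" for i j
    using wsc[OF that(1)] wsc[OF that(2)]
    by (simp add: scalar_prod_def atLeast0LessThan mult.commute)
  have sq: "(\<Sum>k<n. cnj (ws ! i $ k) * (ws ! i $ k)) = N i * N i" if "i < n" for i
  proof -
    have "N i * N i = of_real ((l2_norm_vec (ws ! i))\<^sup>2)" unfolding N_def by (simp add: power2_eq_square)
    also have "\<dots> = (\<Sum>k<n. cnj (ws ! i $ k) * (ws ! i $ k))"
      unfolding l2_norm_vec_square using wsc[OF that]
      by (simp only: of_real_sum complex_norm_square mult.commute carrier_vecD)
    finally show ?thesis by (rule sym)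
  qed
  have N0: "N i \<noteq> 0" if "i < n" for i
  proof
    assume "N i = 0"
    then have "ws ! i \<bullet>c ws ! i = 0"
      using trans[OF sq[OF that, symmetric] prod[OF that that]] by (metis mult_zero_left)
    then show False using corthogonalD[OF ws(2), of i i] that ws(3) by simp
  qed
  have cN: "cnj (N i) = N i" for i unfolding N_def by simp
  have UU: "mat_adjoint U * U = 1\<^sub>m n"
  proof (rule eq_matI)
    fix i j assume "i < dim_row (1\<^sub>m n :: complex mat)" "j < dim_col (1\<^sub>m n :: complex mat)"
    then have ij: "i < n" "j < n" by auto
    have "(mat_adjoint U * U) $$ (i, j) = (\<Sum>k<n. (cnj (ws ! i $ k) * (ws ! j $ k)) / (N i * N j))"
      using ij by (simp add: U_def scalar_prod_def atLeast0LessThan index_mat_adjoint cN)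
    also have "\<dots> = (\<Sum>k<n. cnj (ws ! i $ k) * (ws ! j $ k)) / (N i * N j)"
      by (rule sum_divide_distrib[symmetric])
    also have "\<dots> = (if i = j then 1 else 0)"
    proof (cases "i = j")
      case True
      then show ?thesis using sq[OF ij(1)] N0[OF ij(1)] by simp
    next
      case False
      then show ?thesis using prod[OF ij] corthogonalD[OF ws(2), of j i] ij ws(3) by simp
    qed
    finally show "(mat_adjoint U * U) $$ (i, j) = 1\<^sub>m n $$ (i, j)" using ij by simp
  qed (auto simp: U_def)
  have "ws ! 0 = v" using hdws ws(3) n by (cases ws) auto
  then have "col U 0 = (1 / N 0) \<cdot>\<^sub>v v"
    using n v(1) by (intro eq_vecI) (auto simp: U_def)
  then show ?thesis using unitary_matI[OF U UU] by blast
qed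

lemma dim_mat_diag: "dim_row (mat_diag n d) = n" "dim_col (mat_diag n d) = n"
  by (simp_all add: mat_diag_def)

lemma mat_adjoint_mat_diag:
  "mat_adjoint (mat_diag n d) = mat_diag n (\<lambda>i. cnj (d i))"
  by (rule eq_matI) (auto simp: index_mat_adjoint mat_diag_def)

lemma block_diag_mult:
  fixes E F B C :: "complex mat"
  assumes E: "E \<in> carrier_mat m m" and F: "F \<in> carrier_mat m m"
    and B: "B \<in> carrier_mat n n" and C: "C \<in> carrier_mat n n"
  shows "four_block_mat E (0\<^sub>m m n) (0\<^sub>m n m) B * four_block_mat F (0\<^sub>m m n) (0\<^sub>m n m) C
    = four_block_mat (E * F) (0\<^sub>m m n) (0\<^sub>m n m) (B * C)"
proof -
  have EF: "E * F \<in> carrier_mat m m" and BC: "B * C \<in> carrier_mat n n" using assms by auto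
  show ?thesis
    unfolding mult_four_block_mat[OF E zero_carrier_mat zero_carrier_mat B F zero_carrier_mat zero_carrier_mat C]
    by (simp only: left_mult_zero_mat[OF F] left_mult_zero_mat[OF C] right_mult_zero_mat[OF E] right_mult_zero_mat[OF B]
        left_mult_zero_mat[OF zero_carrier_mat] right_add_zero_mat[OF EF] left_add_zero_mat[OF BC]
        right_add_zero_mat[OF zero_carrier_mat])
qed

text \<open>Deflation: an eigenvector is normalised and completed to a unitary \<open>U\<close>. The
  first column of \<open>A'\<close> then has only its corner entry, Hermitian symmetry clears the
  first row as well and makes the corner real, and the induction hypothesis diagonalises the
  remaining block.\<close>

theorem hermitian_spectral:
  assumes "A \<in> carrier_mat n n" "hermitian_mat A"
  shows "\<exists>U x. unitary_mat n U \<and> A = U * mat_diag n (\<lambda>i. complex_of_real (x i)) * mat_adjoint U"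
  using assms
proof (induction n arbitrary: A)
  case 0
  then have "A = 1\<^sub>m 0 * mat_diag 0 (\<lambda>i. complex_of_real ((\<lambda>_. 0) i)) * mat_adjoint (1\<^sub>m 0)"
    by (intro eq_matI) auto
  then show ?case using unitary_mat_one[of 0] by (intro exI[of _ "1\<^sub>m 0"] exI[of _ "\<lambda>_. 0"] conjI)
next
  case (Suc n A)
  note A = Suc.prems(1)
  obtain e where "e \<in> spectrum A" using spectrum_non_empty[OF A] by auto
  then obtain v where v: "eigenvector A v e" unfolding spectrum_def eigenvalue_def by auto
  then have vc: "v \<in> carrier_vec (Suc n)" "v \<noteq> 0\<^sub>v (Suc n)" and ev: "A *\<^sub>v v = e \<cdot>\<^sub>v v"
    using A unfolding eigenvector_def by auto
  obtain U \<alpha> where U: "unitary_mat (Suc n) U" and col: "col U 0 = \<alpha> \<cdot>\<^sub>v v"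
    using exists_unitary_first_col[OF vc] by blast
  note u = unitary_matD[OF U]
  define A' where "A' = mat_adjoint U * A * U"
  have A': "A' \<in> carrier_mat (Suc n) (Suc n)" unfolding A'_def using u A by auto
  have herm': "mat_adjoint A' = A'"
    using hermitian_sandwich[OF u(2) A Suc.prems(2)] unfolding A'_def hermitian_mat_def
    by (simp add: mat_adjoint_adjoint)
  have herm: "A' $$ (i, j) = cnj (A' $$ (j, i))" if "i < Suc n" "j < Suc n" for i j
  proof -
    have "mat_adjoint A' $$ (i, j) = cnj (A' $$ (j, i))"
      by (rule index_mat_adjoint) (use carrier_matD[OF A'] that in simp_all)
    then show ?thesis by (simp only: herm')
  qed
  have AU: "A * U \<in> carrier_mat (Suc n) (Suc n)" using A u by auto
  have c0: "A' $$ (i, 0) = (if i = 0 then e else 0)" if i: "i < Suc n" for i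
  proof -
    have "col A' 0 = mat_adjoint U *\<^sub>v col (A * U) 0"
      unfolding A'_def assoc_mult_mat[OF u(2) A u(1)] by (rule col_mult2[OF u(2) AU]) simp
    also have "col (A * U) 0 = A *\<^sub>v col U 0" by (rule col_mult2[OF A u(1)]) simp
    also have "\<dots> = e \<cdot>\<^sub>v col U 0" unfolding col using ev mult_mat_vec[OF A vc(1)]
      by (simp add: smult_smult_assoc mult.commute)
    also have "mat_adjoint U *\<^sub>v (e \<cdot>\<^sub>v col U 0) = e \<cdot>\<^sub>v (mat_adjoint U *\<^sub>v col U 0)"
      by (rule mult_mat_vec[OF u(2)]) (rule col_carrier_vec[OF zero_less_Suc u(1)])
    also have "mat_adjoint U *\<^sub>v col U 0 = col (mat_adjoint U * U) 0"
      by (rule col_mult2[OF u(2,1), symmetric]) simp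
    finally have "col A' 0 = e \<cdot>\<^sub>v col (1\<^sub>m (Suc n)) 0" unfolding u(3) .
    then have "col A' 0 $ i = (e \<cdot>\<^sub>v col (1\<^sub>m (Suc n)) 0) $ i" by simp
    then show ?thesis using i A' by auto
  qed
  have r0: "A' $$ (0, i) = (if i = 0 then cnj e else 0)" if i: "i < Suc n" for i
  proof -
    have "A' $$ (0, i) = cnj (A' $$ (i, 0))" using herm[of 0 i] i by simp
    then show ?thesis unfolding c0[OF i] by simp
  qed
  have e: "cnj e = e" using c0[of 0] r0[of 0] by simp
  define B where "B = mat n n (\<lambda>(i, j). A' $$ (Suc i, Suc j))"
  have B: "B \<in> carrier_mat n n" unfolding B_def by simp
  have "hermitian_mat B" unfolding hermitian_mat_def
  proof (rule eq_matI)
    fix i j assume "i < dim_row B" "j < dim_col B"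
    then have ij: "i < n" "j < n" using B by auto
    have "mat_adjoint B $$ (i, j) = cnj (A' $$ (Suc j, Suc i))"
      using ij by (simp add: B_def index_mat_adjoint)
    also have "\<dots> = A' $$ (Suc i, Suc j)" by (rule herm[symmetric]) (use ij in simp_all)
    finally show "mat_adjoint B $$ (i, j) = B $$ (i, j)" using ij by (simp add: B_def)
  qed (use B in auto)
  with Suc.IH[OF B] obtain V x where V: "unitary_mat n V"
    and Bd: "B = V * mat_diag n (\<lambda>i. complex_of_real (x i)) * mat_adjoint V" by blast
  note w = unitary_matD[OF V]
  define E where "E = mat 1 1 (\<lambda>_. e)"
  let ?one = "1\<^sub>m 1 :: complex mat" and ?D = "mat_diag n (\<lambda>i. complex_of_real (x i))"
  let ?zr = "0\<^sub>m 1 n :: complex mat" and ?zc = "0\<^sub>m n 1 :: complex mat"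
  have E: "E \<in> carrier_mat 1 1" unfolding E_def by simp
  define W where "W = four_block_mat ?one ?zr ?zc V"
  define y where "y i = (case i of 0 \<Rightarrow> Re e | Suc i \<Rightarrow> x i)" for i
  have W: "W \<in> carrier_mat (Suc n) (Suc n)" 
    unfolding W_def using four_block_carrier_mat[OF one_carrier_mat[of 1] w(1)] by simp
  have Wadj: "mat_adjoint W = four_block_mat ?one ?zr ?zc (mat_adjoint V)"
    unfolding W_def by (rule eq_matI) (use w(1) in \<open>auto simp: index_mat_adjoint\<close>)
  have Dy: "mat_diag (Suc n) (\<lambda>i. complex_of_real (y i)) = four_block_mat E ?zr ?zc ?D"
    by (rule eq_matI) (use e in \<open>auto simp: mat_diag_def E_def y_def complex_eq_iff split: nat.splits\<close>)
  have WU: "unitary_mat (Suc n) W"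
  proof (rule unitary_matI[OF W])
    have "mat_adjoint W * W = four_block_mat ?one ?zr ?zc (1\<^sub>m n)"
      unfolding Wadj unfolding W_def
      by (simp only: block_diag_mult[OF one_carrier_mat one_carrier_mat w(2,1)] w(3) left_mult_one_mat[OF one_carrier_mat])
    also have "\<dots> = 1\<^sub>m (Suc n)" by (rule eq_matI) auto
    finally show "mat_adjoint W * W = 1\<^sub>m (Suc n)" .
  qed
  have A'b: "A' = four_block_mat E ?zr ?zc B"
  proof (rule eq_matI)
    fix i j assume ij: "i < dim_row (four_block_mat E ?zr ?zc B)" "j < dim_col (four_block_mat E ?zr ?zc B)"
    then show "A' $$ (i, j) = four_block_mat E ?zr ?zc B $$ (i, j)"
      using B E c0[of i] r0[of j] by (cases i; cases j) (auto simp: E_def e B_def)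
  qed (use A' B E in auto)
  have "W * mat_diag (Suc n) (\<lambda>i. complex_of_real (y i)) = four_block_mat E ?zr ?zc (V * ?D)"
    unfolding Dy unfolding W_def
    by (simp only: block_diag_mult[OF one_carrier_mat E w(1) mat_diag_dim] left_mult_one_mat[OF E])
  then have "W * mat_diag (Suc n) (\<lambda>i. complex_of_real (y i)) * mat_adjoint W
      = four_block_mat E ?zr ?zc (V * ?D) * four_block_mat ?one ?zr ?zc (mat_adjoint V)"
    by (simp only: Wadj)
  also have "\<dots> = four_block_mat E ?zr ?zc (V * ?D * mat_adjoint V)"
    by (simp only: block_diag_mult[OF E one_carrier_mat mult_carrier_mat[OF w(1) mat_diag_dim] w(2)] right_mult_one_mat[OF E])
  also have "\<dots> = A'" unfolding A'b Bd ..
  finally have A'W: "A' = W * mat_diag (Suc n) (\<lambda>i. complex_of_real (y i)) * mat_adjoint W" ..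
  have "A = U * A' * mat_adjoint U"
    unfolding A'_def by (rule unitary_sandwich_cancel(2)[OF U A, symmetric])
  also have "\<dots> = (U * W) * mat_diag (Suc n) (\<lambda>i. complex_of_real (y i)) * mat_adjoint (U * W)"
    unfolding A'W by (rule sandwich_sandwich[OF u(1) W mat_diag_dim])
  finally show ?case using unitary_mat_mult[OF U WU] by (intro exI[of _ "U * W"] exI[of _ y] conjI)
qed

corollary hermitian_spectralE:
  assumes "A \<in> carrier_mat n n" "hermitian_mat A"
  obtains U x where "unitary_mat n U"
    and "A = U * mat_diag n (\<lambda>i. complex_of_real (x i)) * mat_adjoint U"
  using hermitian_spectral[OF assms] by (elim exE conjE)

section \<open>Frobenius and operator norms\<close>

lemma frob_norm_mat_adjoint: "frob_norm (mat_adjoint M) = frob_norm M"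
proof -
  have "(\<Sum>i<dim_col M. \<Sum>j<dim_row M. (cmod (mat_adjoint M $$ (i, j)))\<^sup>2)
      = (\<Sum>i<dim_col M. \<Sum>j<dim_row M. (cmod (M $$ (j, i)))\<^sup>2)"
    by (intro sum.cong) (auto simp: index_mat_adjoint)
  also have "\<dots> = (\<Sum>j<dim_row M. \<Sum>i<dim_col M. (cmod (M $$ (j, i)))\<^sup>2)" by (rule sum.swap)
  finally show ?thesis unfolding frob_norm_def by simp
qed

lemma frob_norm_unitary_left:
  assumes U: "unitary_mat n U" and M: "M \<in> carrier_mat n m"
  shows "frob_norm (U * M) = frob_norm M"
proof -
  note u = unitary_matD[OF U]
  have "mat_adjoint (U * M) * (U * M) = mat_adjoint M * (mat_adjoint U * (U * M))"
    unfolding mat_adjoint_mult[OF u(1) M]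
    using carrier_matD[OF u(1)] carrier_matD[OF M] by (simp add: mat_mult_assoc_dim del: assoc_mult_mat)
  also have "\<dots> = mat_adjoint M * M"
    using carrier_matD[OF M] by (simp only: unitary_mult_cancel[OF U])
  finally have "complex_of_real ((frob_norm (U * M))\<^sup>2) = complex_of_real ((frob_norm M)\<^sup>2)"
    unfolding frob_norm_square_trace by simp
  then show ?thesis unfolding of_real_eq_iff by (simp add: frob_norm_nonneg)
qed

lemma frob_norm_unitary_sandwich:
  assumes U: "unitary_mat n U" and M: "M \<in> carrier_mat n n"
  shows "frob_norm (U * M * mat_adjoint U) = frob_norm M"
proof -
  note u = unitary_matD[OF U]
  have "frob_norm (U * M * mat_adjoint U) = frob_norm (U * M)"
  proof -
    have UM: "U * M \<in> carrier_mat n n" using u(1) M by simp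
    have "frob_norm (U * M * mat_adjoint U) = frob_norm (mat_adjoint (U * M * mat_adjoint U))"
      by (rule frob_norm_mat_adjoint[symmetric])
    also have "mat_adjoint (U * M * mat_adjoint U) = U * mat_adjoint (U * M)"
      unfolding mat_adjoint_mult[OF UM u(2)] mat_adjoint_adjoint ..
    also have "frob_norm \<dots> = frob_norm (mat_adjoint (U * M))"
      by (rule frob_norm_unitary_left[OF U mat_adjoint_carrier[OF UM]])
    finally show ?thesis unfolding frob_norm_mat_adjoint .
  qed
  also have "\<dots> = frob_norm M" by (rule frob_norm_unitary_left[OF U M])
  finally show ?thesis .
qed

lemma frob_norm_mat_diag: "frob_norm (mat_diag n d) = sqrt (\<Sum>i<n. (cmod (d i))\<^sup>2)"
proof -
  have "(\<Sum>j<n. (cmod (mat_diag n d $$ (i, j)))\<^sup>2) = (cmod (d i))\<^sup>2" if "i < n" for i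
  proof -
    have "(\<Sum>j<n. (cmod (mat_diag n d $$ (i, j)))\<^sup>2) = (\<Sum>j<n. if i = j then (cmod (d i))\<^sup>2 else 0)"
      using that by (intro sum.cong) (auto simp: mat_diag_def)
    then show ?thesis using that by simp
  qed
  then show ?thesis unfolding frob_norm_def dim_mat_diag by simp
qed

lemma mat_trace_mat_diag: "mat_trace (mat_diag n d) = (\<Sum>i<n. d i)"
  unfolding mat_trace_def dim_mat_diag by (intro sum.cong) (auto simp: mat_diag_def)

lemma mat_trace_unitary_sandwich:
  assumes U: "unitary_mat n U" and M: "M \<in> carrier_mat n n"
  shows "mat_trace (U * M * mat_adjoint U) = mat_trace M"
proof -
  note u = unitary_matD[OF U]
  have UM: "U * M \<in> carrier_mat n n" using u(1) M by simp
  have "mat_trace (U * M * mat_adjoint U) = mat_trace (mat_adjoint U * (U * M))"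
    by (rule mat_trace_mult_commute[OF UM u(2)])
  then show ?thesis using unitary_mult_cancel(1)[OF U] carrier_matD[OF M] by simp
qed

lemma det_mat_diag: "det (mat_diag n d) = (\<Prod>i<n. d i)"
proof -
  have "det (mat_diag n d) = prod_list (diag_mat (mat_diag n d))"
    by (rule det_upper_triangular[of _ n]) (auto simp: mat_diag_def upper_triangular_def)
  also have "\<dots> = (\<Prod>i<n. d i)"
    unfolding prod_list_diag_prod dim_mat_diag by (intro prod.cong) (auto simp: mat_diag_def)
  finally show ?thesis .
qed

lemma det_unitary_sandwich:
  assumes U: "unitary_mat n U" and M: "M \<in> carrier_mat n n"
  shows "det (U * M * mat_adjoint U) = det M"
proof -
  note u = unitary_matD[OF U]
  have UM: "U * M \<in> carrier_mat n n" using u(1) M by simp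
  have "det U * det (mat_adjoint U) = det (1\<^sub>m n :: complex mat)"
    unfolding u(4)[symmetric] by (rule det_mult[OF u(1,2), symmetric])
  then have "det U * det (mat_adjoint U) = 1" by simp
  then show ?thesis unfolding det_mult[OF UM u(2)] det_mult[OF u(1) M] by (simp add: mult_ac)
qed

lemma index_diag_sandwich:
  assumes P: "P \<in> carrier_mat m n" and ij: "i < m" "j < m"
  shows "(P * mat_diag n d * mat_adjoint P) $$ (i, j) = (\<Sum>k<n. P $$ (i, k) * d k * cnj (P $$ (j, k)))"
  unfolding mat_diag_mult_right[OF P]
  using carrier_matD[OF P] ij by (simp add: scalar_prod_def atLeast0LessThan index_mat_adjoint)

lemma unitary_sandwich_carrier:
  assumes U: "unitary_mat n U" and M: "M \<in> carrier_mat n n"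
  shows "U * M * mat_adjoint U \<in> carrier_mat n n"
  by (rule mult_carrier_mat[OF mult_carrier_mat[OF unitary_matD(1)[OF U] M] unitary_matD(2)[OF U]])

lemma unitary_diag_one:
  assumes U: "unitary_mat n U"
  shows "U * mat_diag n (\<lambda>_. 1) * mat_adjoint U = 1\<^sub>m n"
  by (simp only: mat_diag_one right_mult_one_mat[OF unitary_matD(1)[OF U]] unitary_matD(4)[OF U])

lemma unitary_diag_diff:
  assumes U: "unitary_mat n U"
  shows "U * mat_diag n d * mat_adjoint U - U * mat_diag n e * mat_adjoint U
    = U * mat_diag n (\<lambda>i. d i - e i) * mat_adjoint U"
proof (rule eq_matI)
  note u = unitary_matD(1)[OF U]
  fix i j
  assume "i < dim_row (U * mat_diag n (\<lambda>i. d i - e i) * mat_adjoint U)"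
    "j < dim_col (U * mat_diag n (\<lambda>i. d i - e i) * mat_adjoint U)"
  then have ij: "i < n" "j < n" using carrier_matD[OF u] by auto
  have "(U * mat_diag n d * mat_adjoint U - U * mat_diag n e * mat_adjoint U) $$ (i, j)
      = (U * mat_diag n d * mat_adjoint U) $$ (i, j) - (U * mat_diag n e * mat_adjoint U) $$ (i, j)"
    by (rule index_minus_mat(1)) (use ij carrier_matD[OF u] in simp_all)
  then show "(U * mat_diag n d * mat_adjoint U - U * mat_diag n e * mat_adjoint U) $$ (i, j)
      = (U * mat_diag n (\<lambda>i. d i - e i) * mat_adjoint U) $$ (i, j)"
    unfolding index_diag_sandwich[OF u ij]
    by (simp add: right_diff_distrib left_diff_distrib sum_subtractf)
qed (use carrier_matD[OF unitary_matD(1)[OF U]] in simp_all)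

lemma unitary_diag_scalar:
  assumes U: "unitary_mat n U"
  shows "U * mat_diag n (\<lambda>_. c) * mat_adjoint U = c \<cdot>\<^sub>m 1\<^sub>m n"
proof (rule eq_matI)
  note u = unitary_matD[OF U]
  fix i j assume "i < dim_row (c \<cdot>\<^sub>m 1\<^sub>m n)" "j < dim_col (c \<cdot>\<^sub>m 1\<^sub>m n)"
  then have ij: "i < n" "j < n" by auto
  have "1\<^sub>m n $$ (i, j) = (\<Sum>k<n. U $$ (i, k) * 1 * cnj (U $$ (j, k)))"
    unfolding index_diag_sandwich[OF u(1) ij, symmetric] unitary_diag_one[OF U] ..
  then show "(U * mat_diag n (\<lambda>_. c) * mat_adjoint U) $$ (i, j) = (c \<cdot>\<^sub>m 1\<^sub>m n) $$ (i, j)"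
    unfolding index_diag_sandwich[OF u(1) ij] using ij by (simp add: sum_distrib_left mult_ac)
qed (use carrier_matD[OF unitary_matD(1)[OF U]] in simp_all)

lemma unitary_diag_minus_scalar:
  assumes U: "unitary_mat n U"
  shows "U * mat_diag n d * mat_adjoint U - c \<cdot>\<^sub>m 1\<^sub>m n = U * mat_diag n (\<lambda>i. d i - c) * mat_adjoint U"
  unfolding unitary_diag_scalar[OF U, symmetric] by (rule unitary_diag_diff[OF U])

lemma l2_norm_vec_unitary:
  assumes U: "unitary_mat n U" and v: "v \<in> carrier_vec n"
  shows "l2_norm_vec (U *\<^sub>v v) = l2_norm_vec v"
proof -
  note u = unitary_matD[OF U]
  \<comment> \<open>The vector is read as a matrix with one column, so unitary invariance of the
    Frobenius norm applies.\<close>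
  define M where "M = mat n 1 (\<lambda>(i, j). v $ i)"
  have M: "M \<in> carrier_mat n 1" unfolding M_def by simp
  have 1: "frob_norm M = l2_norm_vec v"
    using carrier_vecD[OF v] by (simp add: frob_norm_def l2_norm_vec_def M_def)
  have colM: "col M 0 = v" using carrier_vecD[OF v] by (intro eq_vecI) (auto simp: M_def)
  have "(U * M) $$ (i, 0) = (U *\<^sub>v v) $ i" if "i < n" for i
    using that carrier_matD[OF u(1)] carrier_matD[OF M] colM by simp
  then have "frob_norm (U * M) = l2_norm_vec (U *\<^sub>v v)"
    using carrier_matD[OF u(1)] carrier_matD[OF M] by (simp add: frob_norm_def l2_norm_vec_def)
  then show ?thesis using frob_norm_unitary_left[OF U M] 1 by simp
qed

section \<open>Cauchy-Schwarz and the operator norm\<close>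

lemma cmod_sum_mult_le:
  fixes f g :: "'a \<Rightarrow> complex"
  shows "cmod (\<Sum>i\<in>I. f i * g i) \<le> sqrt (\<Sum>i\<in>I. (cmod (f i))\<^sup>2) * sqrt (\<Sum>i\<in>I. (cmod (g i))\<^sup>2)"
proof -
  have "cmod (\<Sum>i\<in>I. f i * g i) \<le> (\<Sum>i\<in>I. cmod (f i) * cmod (g i))"
    by (rule order_trans[OF norm_sum]) (simp add: norm_mult)
  also have "\<dots> \<le> \<bar>\<Sum>i\<in>I. cmod (f i) * cmod (g i)\<bar>" by simp
  also have "\<dots> \<le> sqrt (\<Sum>i\<in>I. (cmod (f i))\<^sup>2) * sqrt (\<Sum>i\<in>I. (cmod (g i))\<^sup>2)"
    by (rule abs_sum_mult_le_sqrt)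
  finally show ?thesis .
qed

text \<open>Provides the upper bound that makes the supremum in \<open>op_norm_mat\<close>
  meaningful.\<close>

lemma l2_norm_mult_le_frob:
  assumes v: "v \<in> carrier_vec (dim_col A)"
  shows "l2_norm_vec (A *\<^sub>v v) \<le> frob_norm A * l2_norm_vec v"
proof (rule power2_le_imp_le)
  have "(cmod ((A *\<^sub>v v) $ i))\<^sup>2 \<le> (\<Sum>j<dim_col A. (cmod (A $$ (i, j)))\<^sup>2) * (l2_norm_vec v)\<^sup>2"
    if i: "i < dim_row A" for i
  proof -
    have "(A *\<^sub>v v) $ i = (\<Sum>j<dim_col A. A $$ (i, j) * v $ j)"
      using i carrier_vecD[OF v] by (simp add: scalar_prod_def atLeast0LessThan)
    then have "cmod ((A *\<^sub>v v) $ i) \<le> sqrt (\<Sum>j<dim_col A. (cmod (A $$ (i, j)))\<^sup>2) * l2_norm_vec v"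
      unfolding l2_norm_vec_def carrier_vecD[OF v] by (simp add: cmod_sum_mult_le)
    then have "(cmod ((A *\<^sub>v v) $ i))\<^sup>2 \<le> (sqrt (\<Sum>j<dim_col A. (cmod (A $$ (i, j)))\<^sup>2) * l2_norm_vec v)\<^sup>2"
      by (rule power_mono) simp
    then show ?thesis by (simp add: power_mult_distrib sum_nonneg)
  qed
  then have "(\<Sum>i<dim_row A. (cmod ((A *\<^sub>v v) $ i))\<^sup>2)
      \<le> (\<Sum>i<dim_row A. (\<Sum>j<dim_col A. (cmod (A $$ (i, j)))\<^sup>2) * (l2_norm_vec v)\<^sup>2)"
    by (intro sum_mono) simp
  then show "(l2_norm_vec (A *\<^sub>v v))\<^sup>2 \<le> (frob_norm A * l2_norm_vec v)\<^sup>2"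
    unfolding l2_norm_vec_square[of "A *\<^sub>v v"] power_mult_distrib frob_norm_square
    by (simp add: sum_distrib_right)
  show "0 \<le> frob_norm A * l2_norm_vec v" by (simp add: frob_norm_nonneg l2_norm_vec_nonneg)
qed

lemma op_norm_mat_le:
  assumes "\<And>v. v \<in> carrier_vec (dim_col A) \<Longrightarrow> l2_norm_vec v \<le> 1 \<Longrightarrow> l2_norm_vec (A *\<^sub>v v) \<le> B"
  shows "op_norm_mat A \<le> B"
  unfolding op_norm_mat_def
proof (rule cSup_least)
  have "l2_norm_vec (0\<^sub>v (dim_col A)) \<le> 1" by (simp add: l2_norm_vec_def)
  then show "{l2_norm_vec (A *\<^sub>v v) |v. v \<in> carrier_vec (dim_col A) \<and> l2_norm_vec v \<le> 1} \<noteq> {}"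
    using zero_carrier_vec by blast
qed (use assms in blast)

lemma l2_norm_mult_le_op_norm:
  assumes "v \<in> carrier_vec (dim_col A)" "l2_norm_vec v \<le> 1"
  shows "l2_norm_vec (A *\<^sub>v v) \<le> op_norm_mat A"
  unfolding op_norm_mat_def
proof (rule cSup_upper)
  show "bdd_above {l2_norm_vec (A *\<^sub>v v) |v. v \<in> carrier_vec (dim_col A) \<and> l2_norm_vec v \<le> 1}"
  proof (rule bdd_aboveI[of _ "frob_norm A"], clarify)
    fix v assume "v \<in> carrier_vec (dim_col A)" "l2_norm_vec v \<le> 1"
    then show "l2_norm_vec (A *\<^sub>v v) \<le> frob_norm A"
      using l2_norm_mult_le_frob[of v A] mult_left_mono[of "l2_norm_vec v" 1 "frob_norm A"]
      by (simp add: frob_norm_nonneg)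
  qed
qed (use assms in blast)

lemma op_norm_unitary_diag_le:
  assumes U: "unitary_mat n U" and d: "\<And>i. i < n \<Longrightarrow> cmod (d i) \<le> B" and B: "0 \<le> B"
  shows "op_norm_mat (U * mat_diag n d * mat_adjoint U) \<le> B"
proof (rule op_norm_mat_le)
  note u = unitary_matD[OF U]
  fix v :: "complex vec"
  assume "v \<in> carrier_vec (dim_col (U * mat_diag n d * mat_adjoint U))" and v1: "l2_norm_vec v \<le> 1"
  then have v: "v \<in> carrier_vec n" using carrier_matD[OF u(1)] by simp
  define x where "x = mat_adjoint U *\<^sub>v v"
  have x: "x \<in> carrier_vec n" unfolding x_def by (rule mult_mat_vec_carrier[OF u(2) v])
  have xn: "l2_norm_vec x = l2_norm_vec v"
    unfolding x_def by (rule l2_norm_vec_unitary[OF unitary_mat_adjoint[OF U] v])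
  have UD: "U * mat_diag n d \<in> carrier_mat n n" using u(1) by simp
  have "(U * mat_diag n d * mat_adjoint U) *\<^sub>v v = U *\<^sub>v (mat_diag n d *\<^sub>v x)"
    unfolding x_def assoc_mult_mat_vec[OF UD u(2) v]
    by (rule assoc_mult_mat_vec[OF u(1) mat_diag_dim mult_mat_vec_carrier[OF u(2) v]])
  then have "l2_norm_vec ((U * mat_diag n d * mat_adjoint U) *\<^sub>v v) = l2_norm_vec (mat_diag n d *\<^sub>v x)"
    using l2_norm_vec_unitary[OF U mult_mat_vec_carrier[OF mat_diag_dim x]] by simp
  also have "\<dots> \<le> B * l2_norm_vec x"
  proof (rule power2_le_imp_le)
    have dx: "(mat_diag n d *\<^sub>v x) $ i = d i * x $ i" if "i < n" for i
    proof -
      have "(mat_diag n d *\<^sub>v x) $ i = (\<Sum>j<n. (if i = j then d j else 0) * x $ j)"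
        using that carrier_vecD[OF x] by (simp add: mat_diag_def scalar_prod_def atLeast0LessThan)
      also have "\<dots> = (\<Sum>j<n. if i = j then d i * x $ i else 0)" by (intro sum.cong) auto
      finally show ?thesis using that by simp
    qed
    have "(l2_norm_vec (mat_diag n d *\<^sub>v x))\<^sup>2 = (\<Sum>i<n. (cmod (d i))\<^sup>2 * (cmod (x $ i))\<^sup>2)"
      unfolding l2_norm_vec_square
      by (intro sum.cong) (auto simp: dx dim_mat_diag norm_mult power_mult_distrib simp del: index_mult_mat_vec)
    also have "\<dots> \<le> (\<Sum>i<n. B\<^sup>2 * (cmod (x $ i))\<^sup>2)"
      using d by (intro sum_mono mult_right_mono power_mono) auto
    also have "\<dots> = (B * l2_norm_vec x)\<^sup>2"
      unfolding power_mult_distrib l2_norm_vec_square carrier_vecD[OF x] by (simp add: sum_distrib_left)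
    finally show "(l2_norm_vec (mat_diag n d *\<^sub>v x))\<^sup>2 \<le> (B * l2_norm_vec x)\<^sup>2" .
    show "0 \<le> B * l2_norm_vec x" using B by (simp add: l2_norm_vec_nonneg)
  qed
  also have "\<dots> \<le> B * 1" unfolding xn using v1 B by (rule mult_left_mono)
  finally show "l2_norm_vec ((U * mat_diag n d * mat_adjoint U) *\<^sub>v v) \<le> B" by simp
qed

text \<open>The entry is the quadratic form of \<open>M\<close> at the k-th column of
  \<open>U\<close>, a unit vector. This is how the operator norm balance conditions turn into bounds
  on individual row and column sums.\<close>

lemma cmod_unitary_conj_diag_le_op_norm:
  assumes U: "unitary_mat n U" and M: "M \<in> carrier_mat n n" and k: "k < n"
  shows "cmod ((mat_adjoint U * M * U) $$ (k, k)) \<le> op_norm_mat M"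
proof -
  note u = unitary_matD[OF U]
  define v where "v = col U k"
  have v: "v \<in> carrier_vec n" unfolding v_def by (rule col_carrier_vec[OF k u(1)])
  have vi: "v $ i = U $$ (i, k)" if "i < n" for i
    unfolding v_def using that k carrier_matD[OF u(1)] by simp
  have "(mat_adjoint U * U) $$ (k, k) = (\<Sum>i<n. cnj (U $$ (i, k)) * U $$ (i, k))"
    using k carrier_matD[OF u(1)] by (simp add: scalar_prod_def atLeast0LessThan index_mat_adjoint)
  then have "(1 :: complex) = of_real (\<Sum>i<n. (cmod (U $$ (i, k)))\<^sup>2)"
    unfolding u(3) of_real_sum complex_norm_square using k by (simp add: mult.commute)
  then have "(\<Sum>i<n. (cmod (U $$ (i, k)))\<^sup>2) = 1" by (metis of_real_1 of_real_eq_iff)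
  then have v1: "l2_norm_vec v = 1"
    unfolding l2_norm_vec_def carrier_vecD[OF v] using vi by simp
  have MU: "M * U \<in> carrier_mat n n" using M u(1) by simp
  have Mv: "(M * U) $$ (i, k) = (M *\<^sub>v v) $ i" if "i < n" for i
    unfolding v_def using that k carrier_matD[OF u(1)] carrier_matD[OF M] by simp
  have "(mat_adjoint U * M * U) $$ (k, k) = (\<Sum>i<n. cnj (U $$ (i, k)) * (M *\<^sub>v v) $ i)"
    unfolding assoc_mult_mat[OF u(2) M u(1)]
    using k carrier_matD[OF u(1)] carrier_matD[OF MU] Mv
    by (subst index_mult_mat) (simp_all add: scalar_prod_def atLeast0LessThan index_mat_adjoint del: index_mult_mat)
  then have "cmod ((mat_adjoint U * M * U) $$ (k, k))
      \<le> sqrt (\<Sum>i<n. (cmod (cnj (U $$ (i, k))))\<^sup>2) * sqrt (\<Sum>i<n. (cmod ((M *\<^sub>v v) $ i))\<^sup>2)"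
    by (simp only: cmod_sum_mult_le)
  also have "\<dots> = l2_norm_vec v * l2_norm_vec (M *\<^sub>v v)"
    unfolding l2_norm_vec_def carrier_vecD[OF v] using vi carrier_matD[OF M] by simp
  also have "\<dots> \<le> op_norm_mat M"
    using l2_norm_mult_le_op_norm[of v M] v v1 carrier_matD[OF M] by simp
  finally show ?thesis .
qed

section \<open>Kraus maps in unitary bases\<close>

lemma kraus_map_carrier [simp]: "kraus_map n As X \<in> carrier_mat n n"
  by (simp add: kraus_map_def)

lemma kraus_dual_carrier [simp]: "kraus_dual p As X \<in> carrier_mat p p"
  by (simp add: kraus_dual_def)

lemma kraus_map_scaled:
  assumes As: "set As \<subseteq> carrier_mat n p" and L: "L \<in> carrier_mat p p" and R: "R \<in> carrier_mat n n"
    and X: "X \<in> carrier_mat p p"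
  shows "kraus_map n (map (\<lambda>A. R * A * mat_adjoint L) As) X
    = R * kraus_map n As (mat_adjoint L * X * L) * mat_adjoint R"
proof -
  have "kraus_rep p n (kraus_map n As) As" using As unfolding kraus_rep_def by simp
  from kraus_rep_scaling[OF this L R]
  have "scaling (kraus_map n As) L R X = kraus_map n (map (\<lambda>A. R * A * mat_adjoint L) As) X"
    using X unfolding kraus_rep_def by blast
  then show ?thesis unfolding scaling_def by (rule sym)
qed

text \<open>Lets facts about Kraus maps be applied to the dual, with the roles of p and n
  exchanged.\<close>

lemma kraus_dual_eq_kraus_map: "kraus_dual p As Y = kraus_map p (map mat_adjoint As) Y"
  unfolding kraus_dual_def kraus_map_def by (simp add: comp_def mat_adjoint_adjoint)

lemma kraus_dual_scaled:
  assumes As: "set As \<subseteq> carrier_mat n p" and L: "L \<in> carrier_mat p p" and R: "R \<in> carrier_mat n n"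
    and Y: "Y \<in> carrier_mat n n"
  shows "kraus_dual p (map (\<lambda>A. R * A * mat_adjoint L) As) Y
    = L * kraus_dual p As (mat_adjoint R * Y * R) * mat_adjoint L"
proof -
  have adj: "mat_adjoint (R * A * mat_adjoint L) = L * mat_adjoint A * mat_adjoint R" if "A \<in> set As" for A
    using mat_adjoint_sandwich[OF R subsetD[OF As that] mat_adjoint_carrier[OF L]]
    unfolding mat_adjoint_adjoint .
  have eq: "map mat_adjoint (map (\<lambda>A. R * A * mat_adjoint L) As)
      = map (\<lambda>B. L * B * mat_adjoint R) (map mat_adjoint As)"
    unfolding map_map comp_def by (rule map_cong[OF refl adj])
  have As': "set (map mat_adjoint As) \<subseteq> carrier_mat p n"
    unfolding set_map using As mat_adjoint_carrier by blast
  show ?thesis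
    unfolding kraus_dual_eq_kraus_map eq by (rule kraus_map_scaled[OF As' R L Y])
qed

lemma hermitian_kraus_map:
  assumes As: "set As \<subseteq> carrier_mat n p" and X: "X \<in> carrier_mat p p" "hermitian_mat X"
  shows "hermitian_mat (kraus_map n As X)"
  unfolding hermitian_mat_def
proof (rule eq_matI)
  fix i j assume "i < dim_row (kraus_map n As X)" "j < dim_col (kraus_map n As X)"
  then have ij: "i < n" "j < n" by (auto simp: kraus_map_def)
  have one: "cnj ((A * X * mat_adjoint A) $$ (j, i)) = (A * X * mat_adjoint A) $$ (i, j)" if "A \<in> set As" for A
  proof -
    have A: "A \<in> carrier_mat n p" using As that by auto
    have "mat_adjoint (A * X * mat_adjoint A) $$ (i, j) = cnj ((A * X * mat_adjoint A) $$ (j, i))"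
      by (rule index_mat_adjoint) (use ij carrier_matD[OF A] in simp_all)
    then show ?thesis using hermitian_sandwich[OF A X] unfolding hermitian_mat_def by simp
  qed
  have "cnj (\<Sum>A\<leftarrow>Bs. f A) = (\<Sum>A\<leftarrow>Bs. cnj (f A))" for f :: "complex mat \<Rightarrow> complex" and Bs
    by (induction Bs) auto
  then have "mat_adjoint (kraus_map n As X) $$ (i, j) = (\<Sum>A\<leftarrow>As. cnj ((A * X * mat_adjoint A) $$ (j, i)))"
    using ij by (simp add: index_mat_adjoint kraus_map_def)
  also have "\<dots> = kraus_map n As X $$ (i, j)"
    unfolding kraus_map_def using ij one by (auto intro!: arg_cong[where f = sum_list])
  finally show "mat_adjoint (kraus_map n As X) $$ (i, j) = kraus_map n As X $$ (i, j)" .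
qed (auto simp: kraus_map_def)

section \<open>The nonnegative matrix attached to a Kraus map\<close>

definition kraus_weight :: "complex mat list \<Rightarrow> nat \<Rightarrow> nat \<Rightarrow> real" where
  "kraus_weight As k l = (\<Sum>A\<leftarrow>As. (cmod (A $$ (k, l)))\<^sup>2)"

lemma kraus_weight_nonneg: "0 \<le> kraus_weight As k l"
  unfolding kraus_weight_def by (induction As) auto

text \<open>A diagonal argument removes the cross terms, so the diagonal of the image is the weight
  matrix applied to \<open>d\<close>. Off-diagonal entries of the image may be nonzero.\<close>

lemma kraus_map_diag_index:
  assumes As: "set As \<subseteq> carrier_mat n p" and k: "k < n"
  shows "kraus_map n As (mat_diag p d) $$ (k, k) = (\<Sum>l<p. of_real (kraus_weight As k l) * d l)"
proof -
  have "(A * mat_diag p d * mat_adjoint A) $$ (k, k) = (\<Sum>l<p. of_real ((cmod (A $$ (k, l)))\<^sup>2) * d l)"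
    if "A \<in> set As" for A
    unfolding index_diag_sandwich[OF subsetD[OF As that] k k] complex_norm_square by (simp add: mult_ac)
  then have "kraus_map n As (mat_diag p d) $$ (k, k)
      = (\<Sum>A\<leftarrow>As. \<Sum>l<p. of_real ((cmod (A $$ (k, l)))\<^sup>2) * d l)"
    unfolding kraus_map_def using k by (auto intro!: arg_cong[where f = sum_list])
  also have "\<dots> = (\<Sum>l<p. of_real (kraus_weight As k l) * d l)"
    unfolding kraus_weight_def by (induction As) (simp_all add: sum.distrib distrib_right)
  finally show ?thesis .
qed

lemma kraus_dual_diag_index:
  assumes As: "set As \<subseteq> carrier_mat n p" and l: "l < p"
  shows "kraus_dual p As (mat_diag n d) $$ (l, l) = (\<Sum>k<n. of_real (kraus_weight As k l) * d k)"
proof -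
  have "kraus_weight (map mat_adjoint As) l k = kraus_weight As k l" if "k < n" for k
    unfolding kraus_weight_def map_map comp_def
  proof (intro arg_cong[where f = sum_list] map_cong refl)
    fix A assume "A \<in> set As"
    then have "A \<in> carrier_mat n p" using As by auto
    then show "(cmod (mat_adjoint A $$ (l, k)))\<^sup>2 = (cmod (A $$ (k, l)))\<^sup>2"
      using l that by (simp add: index_mat_adjoint)
  qed
  moreover have As': "set (map mat_adjoint As) \<subseteq> carrier_mat p n"
    unfolding set_map using As mat_adjoint_carrier by blast
  ultimately show ?thesis
    unfolding kraus_dual_eq_kraus_map kraus_map_diag_index[OF As' l] by simp
qed

text \<open>A change of bases is the scaling with L and R equal to the adjoints of \<open>U\<close>
  and \<open>V\<close>.\<close>

lemma kraus_map_conj: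
  assumes As: "set As \<subseteq> carrier_mat n p" and U: "U \<in> carrier_mat p p" and V: "V \<in> carrier_mat n n"
    and X: "X \<in> carrier_mat p p"
  shows "kraus_map n (map (\<lambda>A. mat_adjoint V * A * U) As) X
    = mat_adjoint V * kraus_map n As (U * X * mat_adjoint U) * V"
  using kraus_map_scaled[OF As mat_adjoint_carrier[OF U] mat_adjoint_carrier[OF V] X]
  unfolding mat_adjoint_adjoint .

lemma kraus_dual_conj:
  assumes As: "set As \<subseteq> carrier_mat n p" and U: "U \<in> carrier_mat p p" and V: "V \<in> carrier_mat n n"
    and Y: "Y \<in> carrier_mat n n"
  shows "kraus_dual p (map (\<lambda>A. mat_adjoint V * A * U) As) Y
    = mat_adjoint U * kraus_dual p As (V * Y * mat_adjoint V) * U"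
  using kraus_dual_scaled[OF As mat_adjoint_carrier[OF U] mat_adjoint_carrier[OF V] Y]
  unfolding mat_adjoint_adjoint .

lemma conj_kraus_carrier:
  assumes As: "set As \<subseteq> carrier_mat n p" and U: "U \<in> carrier_mat p p" and V: "V \<in> carrier_mat n n"
  shows "set (map (\<lambda>A. mat_adjoint V * A * U) As) \<subseteq> carrier_mat n p"
proof -
  have "mat_adjoint V * A * U \<in> carrier_mat n p" if "A \<in> set As" for A
    by (rule mult_carrier_mat[OF mult_carrier_mat[OF mat_adjoint_carrier[OF V] subsetD[OF As that]] U])
  then show ?thesis by (simp add: image_subset_iff)
qed

text \<open>In the bases \<open>U\<close> and \<open>V\<close> both the argument and its image are
  diagonal, so comparing diagonal entries loses nothing.\<close>

lemma kraus_eigenvalues: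
  assumes As: "set As \<subseteq> carrier_mat n p" and U: "unitary_mat p U" and V: "unitary_mat n V"
    and eq: "kraus_map n As (U * mat_diag p (\<lambda>l. complex_of_real (x l)) * mat_adjoint U)
      = V * mat_diag n (\<lambda>k. complex_of_real (m k)) * mat_adjoint V" and k: "k < n"
  shows "m k = (\<Sum>l<p. kraus_weight (map (\<lambda>A. mat_adjoint V * A * U) As) k l * x l)"
proof -
  note u = unitary_matD(1)[OF U] and v = unitary_matD(1)[OF V]
  let ?Bs = "map (\<lambda>A. mat_adjoint V * A * U) As"
  have "kraus_map n ?Bs (mat_diag p (\<lambda>l. complex_of_real (x l))) = mat_diag n (\<lambda>k. complex_of_real (m k))"
    unfolding kraus_map_conj[OF As u v mat_diag_dim] eq by (rule unitary_sandwich_cancel(1)[OF V mat_diag_dim])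
  then have "complex_of_real (m k) = kraus_map n ?Bs (mat_diag p (\<lambda>l. complex_of_real (x l))) $$ (k, k)"
    using k by (simp add: mat_diag_def)
  also have "\<dots> = complex_of_real (\<Sum>l<p. kraus_weight ?Bs k l * x l)"
    unfolding kraus_map_diag_index[OF conj_kraus_carrier[OF As u v] k] by simp
  finally show ?thesis unfolding of_real_eq_iff .
qed

lemma prod_le_mean_power:
  fixes x :: "nat \<Rightarrow> real"
  assumes n: "1 \<le> n" and x: "\<And>i. i < n \<Longrightarrow> 0 \<le> x i"
  shows "(\<Prod>i<n. x i) \<le> ((\<Sum>i<n. x i) / n) ^ n"
proof -
  let ?P = "\<Prod>i<n. x i"
  have P: "0 \<le> ?P" using x by (intro prod_nonneg) auto
  have "?P powr (1 / real n) \<le> (\<Sum>i<n. x i / real n)"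
    using arith_geom_mean[of "{..<n}" x] n x by (simp add: lessThan_empty_iff)
  then have "(?P powr (1 / real n)) ^ n \<le> ((\<Sum>i<n. x i) / n) ^ n"
    by (intro power_mono) (simp_all add: sum_divide_distrib)
  moreover have "(?P powr (1 / real n)) ^ n = ?P"
  proof (cases "?P = 0")
    case True
    then show ?thesis unfolding True using n by simp
  next
    case False
    then show ?thesis using n P by (simp add: powr_power del: prod_zero_iff)
  qed
  ultimately show ?thesis by simp
qed

text \<open>AM-GM for the eigenvalues of the image, which are nonnegative because the weights and
  the eigenvalues of \<open>X\<close> are. It is applied at the identity to bound the minimum, and
  at perturbations of the identity to derive the optimality condition.\<close>

lemma det_kraus_le_trace:
  assumes As: "set As \<subseteq> carrier_mat n p" and n: "1 \<le> n" and U: "unitary_mat p U"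
    and x: "\<And>l. l < p \<Longrightarrow> 0 \<le> x l"
    and X: "X = U * mat_diag p (\<lambda>l. complex_of_real (x l)) * mat_adjoint U"
  shows "Re (det (kraus_map n As X)) \<le> (Re (mat_trace (kraus_map n As X)) / n) ^ n"
proof -
  note u = unitary_matD[OF U]
  have hX: "hermitian_mat X" unfolding X
    by (rule hermitian_sandwich[OF u(1) mat_diag_dim]) (simp add: hermitian_mat_def mat_adjoint_mat_diag)
  have Xc: "X \<in> carrier_mat p p" unfolding X by (rule unitary_sandwich_carrier[OF U mat_diag_dim])
  obtain V m where V: "unitary_mat n V"
    and eq: "kraus_map n As X = V * mat_diag n (\<lambda>k. complex_of_real (m k)) * mat_adjoint V"
    by (rule hermitian_spectralE[OF kraus_map_carrier hermitian_kraus_map[OF As Xc hX]])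
  have m: "0 \<le> m k" if "k < n" for k
    unfolding kraus_eigenvalues[OF As U V eq[unfolded X] that]
    using x by (intro sum_nonneg mult_nonneg_nonneg kraus_weight_nonneg) auto
  have "det (kraus_map n As X) = complex_of_real (\<Prod>k<n. m k)"
    unfolding eq det_unitary_sandwich[OF V mat_diag_dim] det_mat_diag by simp
  moreover have "mat_trace (kraus_map n As X) = complex_of_real (\<Sum>k<n. m k)"
    unfolding eq mat_trace_unitary_sandwich[OF V mat_diag_dim] mat_trace_mat_diag by simp
  ultimately show ?thesis using prod_le_mean_power[of n m, OF n m] by (simp only: Re_complex_of_real)
qed

lemma unitary_conj_minus_scalar:
  assumes V: "unitary_mat n V" and M: "M \<in> carrier_mat n n"
  shows "mat_adjoint V * (M - c \<cdot>\<^sub>m 1\<^sub>m n) * V = mat_adjoint V * M * V - c \<cdot>\<^sub>m 1\<^sub>m n"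
proof -
  note v = unitary_matD[OF V]
  have c1: "c \<cdot>\<^sub>m 1\<^sub>m n \<in> carrier_mat n n" by simp
  have "mat_adjoint V * (M - c \<cdot>\<^sub>m 1\<^sub>m n) = mat_adjoint V * M - c \<cdot>\<^sub>m mat_adjoint V"
    unfolding mult_minus_distrib_mat[OF v(2) M c1] mult_smult_distrib[OF v(2) one_carrier_mat]
      right_mult_one_mat[OF v(2)] ..
  moreover have "(mat_adjoint V * M - c \<cdot>\<^sub>m mat_adjoint V) * V = mat_adjoint V * M * V - c \<cdot>\<^sub>m (mat_adjoint V * V)"
    unfolding minus_mult_distrib_mat[OF mult_carrier_mat[OF v(2) M] smult_carrier_mat[OF v(2)] v(1)]
      mult_smult_assoc_mat[OF v(2,1)] ..
  ultimately show ?thesis unfolding v(3) by simp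
qed

lemma diag_entry_close:
  assumes V: "unitary_mat n V" and M: "M \<in> carrier_mat n n" and k: "k < n"
    and r: "(mat_adjoint V * M * V) $$ (k, k) = complex_of_real r"
    and le: "op_norm_mat (M - complex_of_real c \<cdot>\<^sub>m 1\<^sub>m n) \<le> B"
  shows "\<bar>r - c\<bar> \<le> B"
proof -
  note v = unitary_matD[OF V]
  have "(mat_adjoint V * (M - complex_of_real c \<cdot>\<^sub>m 1\<^sub>m n) * V) $$ (k, k) = complex_of_real (r - c)"
    unfolding unitary_conj_minus_scalar[OF V M] using k r by simp
  then have "\<bar>r - c\<bar> \<le> op_norm_mat (M - complex_of_real c \<cdot>\<^sub>m 1\<^sub>m n)"
    using cmod_unitary_conj_diag_le_op_norm[OF V _ k, of "M - complex_of_real c \<cdot>\<^sub>m 1\<^sub>m n"] M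
    by (metis minus_carrier_mat norm_of_real one_carrier_mat smult_carrier_mat)
  with le show ?thesis by simp
qed

lemma sqrt_sum_diag_le_frob:
  assumes M: "M \<in> carrier_mat n n"
  shows "sqrt (\<Sum>k<n. (cmod (M $$ (k, k)))\<^sup>2) \<le> frob_norm M"
proof -
  have "(cmod (M $$ (k, k)))\<^sup>2 \<le> (\<Sum>j<n. (cmod (M $$ (k, j)))\<^sup>2)" if "k < n" for k
    using that by (intro member_le_sum) auto
  then show ?thesis unfolding frob_norm_def using carrier_matD[OF M] by (auto intro!: sum_mono)
qed

lemma quantum_expander_gap:
  assumes "quantum_expander p n \<epsilon> \<mu> \<Phi>" "X \<in> carrier_mat p p" "hermitian_mat X" "mat_trace X = 0"
  shows "frob_norm (\<Phi> X) \<le> \<mu> * (map_size p \<Phi> / sqrt (real n * real p)) * frob_norm X"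
  using assms unfolding quantum_expander_def by simp

text \<open>Row sums are diagonal entries of \<Phi> 1 in the basis \<open>V\<close>, column sums
  those of the dual at 1 in the basis \<open>U\<close>. The gap is tested on Z = U diag(z) U*, which
  is Hermitian of trace zero; \<open>V\<close> need not diagonalise \<Phi> Z, since discarding
  off-diagonal entries only lowers the Frobenius norm.\<close>

lemma quantum_expander_weights:
  assumes rep: "kraus_rep p n \<Phi> As" and exp: "quantum_expander p n \<epsilon> \<mu> \<Phi>"
    and U: "unitary_mat p U" and V: "unitary_mat n V"
  defines "b \<equiv> kraus_weight (map (\<lambda>A. mat_adjoint V * A * U) As)" and "s \<equiv> map_size p \<Phi>"
  shows "(\<Sum>k<n. \<Sum>l<p. b k l) = s"
    and "k < n \<Longrightarrow> \<bar>(\<Sum>l<p. b k l) - s / n\<bar> \<le> s * \<epsilon> / n"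
    and "l < p \<Longrightarrow> \<bar>(\<Sum>k<n. b k l) - s / p\<bar> \<le> s * \<epsilon> / p"
    and "(\<Sum>l<p. z l) = 0 \<Longrightarrow> sqrt (\<Sum>k<n. (\<Sum>l<p. b k l * z l)\<^sup>2)
      \<le> \<mu> * (s / sqrt (real n * real p)) * sqrt (\<Sum>l<p. (z l)\<^sup>2)"
proof -
  note u = unitary_matD[OF U] and v = unitary_matD[OF V]
  let ?Bs = "map (\<lambda>A. mat_adjoint V * A * U) As"
  have As: "set As \<subseteq> carrier_mat n p" and \<Phi>: "\<And>Y. Y \<in> carrier_mat p p \<Longrightarrow> \<Phi> Y = kraus_map n As Y"
    using rep unfolding kraus_rep_def by auto
  note Bs = conj_kraus_carrier[OF As u(1) v(1)]
  have diag: "kraus_map n ?Bs (mat_diag p d) = mat_adjoint V * \<Phi> (U * mat_diag p d * mat_adjoint U) * V" for d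
    unfolding kraus_map_conj[OF As u(1) v(1) mat_diag_dim]
    unfolding \<Phi>[OF unitary_sandwich_carrier[OF U mat_diag_dim]] ..
  have one: "mat_adjoint V * \<Phi> (1\<^sub>m p) * V = kraus_map n ?Bs (mat_diag p (\<lambda>_. 1))"
    unfolding diag unitary_diag_one[OF U] ..
  have row: "(mat_adjoint V * \<Phi> (1\<^sub>m p) * V) $$ (k, k) = complex_of_real (\<Sum>l<p. b k l)" if "k < n" for k
    unfolding one kraus_map_diag_index[OF Bs that] b_def by simp
  have col: "(mat_adjoint U * kraus_dual p As (1\<^sub>m n) * U) $$ (l, l) = complex_of_real (\<Sum>k<n. b k l)"
    if "l < p" for l
  proof -
    have "mat_adjoint U * kraus_dual p As (1\<^sub>m n) * U = kraus_dual p ?Bs (mat_diag n (\<lambda>_. 1))"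
      unfolding kraus_dual_conj[OF As u(1) v(1) mat_diag_dim] unitary_diag_one[OF V] ..
    then show ?thesis unfolding b_def using kraus_dual_diag_index[OF Bs that, of "\<lambda>_. 1"] by simp
  qed
  have \<Phi>1: "\<Phi> (1\<^sub>m p) \<in> carrier_mat n n" by (simp add: \<Phi>)
  have cp: "completely_positive p n \<Phi>" using rep unfolding completely_positive_def by blast
  have "complex_of_real s = mat_trace (mat_adjoint V * \<Phi> (1\<^sub>m p) * V)"
    unfolding s_def map_size_complex[OF cp]
    using mat_trace_unitary_sandwich[OF unitary_mat_adjoint[OF V] \<Phi>1, symmetric]
    unfolding mat_adjoint_adjoint .
  also have "\<dots> = (\<Sum>k<n. complex_of_real (\<Sum>l<p. b k l))"
    unfolding mat_trace_def using row carrier_matD[OF v(1)] by (intro sum.cong) simp_all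
  finally show "(\<Sum>k<n. \<Sum>l<p. b k l) = s" by (metis of_real_eq_iff of_real_sum)
  have bal: "eps_doubly_balanced p n \<epsilon> \<Phi>" using exp unfolding quantum_expander_def by blast
  show "\<bar>(\<Sum>l<p. b k l) - s / n\<bar> \<le> s * \<epsilon> / n" if "k < n"
    using bal unfolding eps_doubly_balanced_def s_def
    by (intro diag_entry_close[OF V \<Phi>1 that row[OF that]]) blast
  show "\<bar>(\<Sum>k<n. b k l) - s / p\<bar> \<le> s * \<epsilon> / p" if "l < p"
    using bal unfolding eps_doubly_balanced_def s_def dual_map_eq[OF rep one_carrier_mat]
    by (intro diag_entry_close[OF U kraus_dual_carrier that col[OF that]]) blast
  show "sqrt (\<Sum>k<n. (\<Sum>l<p. b k l * z l)\<^sup>2) \<le> \<mu> * (s / sqrt (real n * real p)) * sqrt (\<Sum>l<p. (z l)\<^sup>2)"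
    if z: "(\<Sum>l<p. z l) = 0"
  proof -
    let ?d = "\<lambda>l. complex_of_real (z l)"
    define Z where "Z = U * mat_diag p ?d * mat_adjoint U"
    have Z: "Z \<in> carrier_mat p p" unfolding Z_def by (rule unitary_sandwich_carrier[OF U mat_diag_dim])
    have hZ: "hermitian_mat Z" unfolding Z_def
      by (rule hermitian_sandwich[OF u(1) mat_diag_dim]) (simp add: hermitian_mat_def mat_adjoint_mat_diag)
    have trZ: "mat_trace Z = 0"
      unfolding Z_def mat_trace_unitary_sandwich[OF U mat_diag_dim] mat_trace_mat_diag
      using z by (metis of_real_0 of_real_sum)
    have fZ: "frob_norm Z = sqrt (\<Sum>l<p. (z l)\<^sup>2)"
      unfolding Z_def frob_norm_unitary_sandwich[OF U mat_diag_dim] frob_norm_mat_diag by simp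
    have \<Phi>Z: "\<Phi> Z \<in> carrier_mat n n" by (simp add: \<Phi> Z)
    have K: "kraus_map n ?Bs (mat_diag p ?d) = mat_adjoint V * \<Phi> Z * V"
      unfolding Z_def by (rule diag)
    have "frob_norm (mat_adjoint V * \<Phi> Z * mat_adjoint (mat_adjoint V)) = frob_norm (\<Phi> Z)"
      by (rule frob_norm_unitary_sandwich[OF unitary_mat_adjoint[OF V] \<Phi>Z])
    then have fr: "frob_norm (kraus_map n ?Bs (mat_diag p ?d)) = frob_norm (\<Phi> Z)"
      by (simp only: K mat_adjoint_adjoint)
    have gap: "frob_norm (\<Phi> Z) \<le> \<mu> * (s / sqrt (real n * real p)) * frob_norm Z"
      unfolding s_def
      by (rule quantum_expander_gap[OF exp Z hZ trZ])
    have "(\<Sum>l<p. b k l * z l)\<^sup>2 = (cmod (kraus_map n ?Bs (mat_diag p ?d) $$ (k, k)))\<^sup>2" if "k < n" for k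
    proof -
      have "kraus_map n ?Bs (mat_diag p ?d) $$ (k, k) = complex_of_real (\<Sum>l<p. b k l * z l)"
        unfolding kraus_map_diag_index[OF Bs that] b_def by simp
      then show ?thesis by (simp only: norm_of_real power2_abs)
    qed
    then have sums: "(\<Sum>k<n. (\<Sum>l<p. b k l * z l)\<^sup>2)
        = (\<Sum>k<n. (cmod (kraus_map n ?Bs (mat_diag p ?d) $$ (k, k)))\<^sup>2)"
      by (intro sum.cong) (simp_all only: lessThan_iff)
    have "sqrt (\<Sum>k<n. (\<Sum>l<p. b k l * z l)\<^sup>2) \<le> frob_norm (kraus_map n ?Bs (mat_diag p ?d))"
      unfolding sums by (rule sqrt_sum_diag_le_frob[OF kraus_map_carrier])
    also have "\<dots> = frob_norm (\<Phi> Z)" by (rule fr)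
    also have "\<dots> \<le> \<mu> * (s / sqrt (real n * real p)) * frob_norm Z" by (rule gap)
    finally show ?thesis unfolding fZ .
  qed
qed

section \<open>Minimisation over a Frobenius ball\<close>

text \<open>All conditions are closed. Positive definiteness comes for free when the radius is below
  1, since every eigenvalue lies within \<delta> of 1.\<close>

definition herm_det_ball :: "nat \<Rightarrow> real \<Rightarrow> complex mat set" where
  "herm_det_ball p \<delta> =
    {X \<in> carrier_mat p p. hermitian_mat X \<and> det X = 1 \<and> frob_norm (X - 1\<^sub>m p) \<le> \<delta>}"

lemma continuous_on_det:
  fixes M :: "'a :: topological_space \<Rightarrow> complex mat"
  assumes M: "\<And>x. M x \<in> carrier_mat n n"
    and cont: "\<And>i j. i < n \<Longrightarrow> j < n \<Longrightarrow> continuous_on S (\<lambda>x. M x $$ (i, j))"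
  shows "continuous_on S (\<lambda>x. det (M x))"
proof -
  have perm: "\<pi> i < n" if "\<pi> permutes {0..<n}" "i < n" for \<pi> i
    using permutes_in_image[OF that(1), of i] that(2) by simp
  have "continuous_on S (\<lambda>x. \<Sum>\<pi> | \<pi> permutes {0..<n}. signof \<pi> * (\<Prod>i = 0..<n. M x $$ (i, \<pi> i)))"
    by (intro continuous_intros cont) (auto simp: perm)
  then show ?thesis unfolding det_def'[OF M] .
qed

lemma continuous_on_sum_list:
  fixes f :: "'b \<Rightarrow> 'a :: topological_space \<Rightarrow> complex"
  assumes "\<And>A. A \<in> set As \<Longrightarrow> continuous_on S (f A)"
  shows "continuous_on S (\<lambda>x. \<Sum>A\<leftarrow>As. f A x)"
  using assms by (induction As) (auto intro!: continuous_intros)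

lemma continuous_on_kraus_map_index:
  assumes As: "set As \<subseteq> carrier_mat n p" and ij: "i < n" "j < n"
    and M: "\<And>x. M x \<in> carrier_mat p p"
    and cont: "\<And>k l. k < p \<Longrightarrow> l < p \<Longrightarrow> continuous_on S (\<lambda>x. M x $$ (k, l))"
  shows "continuous_on S (\<lambda>x. kraus_map n As (M x) $$ (i, j))"
proof -
  have "continuous_on S (\<lambda>x. (A * M x * mat_adjoint A) $$ (i, j))" if "A \<in> set As" for A
  proof -
    have A: "A \<in> carrier_mat n p" using As that by auto
    show ?thesis
      unfolding index_sandwich[OF A M mat_adjoint_carrier[OF A] ij]
      by (intro continuous_intros cont) auto
  qed
  then have "continuous_on S (\<lambda>x. \<Sum>A\<leftarrow>As. (A * M x * mat_adjoint A) $$ (i, j))"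
    by (rule continuous_on_sum_list)
  then show ?thesis unfolding kraus_map_def using ij by simp
qed

lemma frob_norm_minus_one:
  assumes X: "X \<in> carrier_mat p p"
  shows "frob_norm (X - 1\<^sub>m p) = sqrt (\<Sum>i<p. \<Sum>j<p. (cmod (X $$ (i, j) - (if i = j then 1 else 0)))\<^sup>2)"
proof -
  have "(\<Sum>i<p. \<Sum>j<p. (cmod ((X - 1\<^sub>m p) $$ (i, j)))\<^sup>2)
      = (\<Sum>i<p. \<Sum>j<p. (cmod (X $$ (i, j) - (if i = j then 1 else 0)))\<^sup>2)"
    using carrier_matD[OF X] by (intro sum.cong) auto
  then show ?thesis unfolding frob_norm_def by simp
qed

lemma continuous_on_frob_norm_minus_one:
  assumes M: "\<And>x. M x \<in> carrier_mat p p"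
    and cont: "\<And>i j. i < p \<Longrightarrow> j < p \<Longrightarrow> continuous_on S (\<lambda>x. M x $$ (i, j))"
  shows "continuous_on S (\<lambda>x. frob_norm (M x - 1\<^sub>m p))"
  unfolding frob_norm_minus_one[OF M] by (intro continuous_intros cont) auto

lemma cmod_index_le_frob:
  assumes "i < dim_row M" "j < dim_col M"
  shows "cmod (M $$ (i, j)) \<le> frob_norm M"
proof -
  have "(cmod (M $$ (i, j)))\<^sup>2 \<le> (\<Sum>j<dim_col M. (cmod (M $$ (i, j)))\<^sup>2)"
    using assms by (intro member_le_sum) auto
  also have "\<dots> \<le> (\<Sum>i<dim_row M. \<Sum>j<dim_col M. (cmod (M $$ (i, j)))\<^sup>2)"
    using assms by (intro member_le_sum[where f = "\<lambda>i. \<Sum>j<dim_col M. (cmod (M $$ (i, j)))\<^sup>2"])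
      (auto intro: sum_nonneg)
  finally show ?thesis unfolding frob_norm_square[symmetric]
    by (rule power2_le_imp_le) (rule frob_norm_nonneg)
qed

text \<open>Compactness is established for the entry functions on pairs of indices, in the product
  topology. Tychonoff gives a compact product of squares, and the conditions defining the ball cut
  out a closed subset, each being an equation or inequality between continuous functions of the
  entries.\<close>

lemma herm_det_ball_minimum:
  fixes F :: "complex mat \<Rightarrow> real"
  assumes cont: "continuous_on UNIV (\<lambda>f. F (mat p p f))" and \<delta>: "0 \<le> \<delta>"
  shows "\<exists>X \<in> herm_det_ball p \<delta>. \<forall>Y \<in> herm_det_ball p \<delta>. F X \<le> F Y"
proof -
  let ?m = "\<lambda>f. mat p p f :: complex mat"
  \<comment> \<open>A square containing every possible entry: an entry of X - 1 is at most \<delta>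
    in modulus, and the identity contributes at most 1.\<close>
  define Q where "Q = (\<lambda>xy. complex_of_real (fst xy) + \<i> * complex_of_real (snd xy))
      ` ({- (\<delta> + 1)..\<delta> + 1} \<times> {- (\<delta> + 1)..\<delta> + 1})"
  have Q: "compact Q"
    unfolding Q_def by (intro compact_continuous_image compact_Times compact_Icc continuous_intros)
  have inQ: "z \<in> Q" if "cmod z \<le> \<delta> + 1" for z
    unfolding Q_def using that abs_Re_le_cmod[of z] abs_Im_le_cmod[of z] complex_eq[of z]
    by (intro image_eqI[where x = "(Re z, Im z)"]) auto
  \<comment> \<open>Coordinates outside the p by p block do not affect the matrix; pinning them to 0
    keeps all factors of the infinite product compact.\<close>
  define S :: "nat \<times> nat \<Rightarrow> complex set" where
    "S ij = (if fst ij < p \<and> snd ij < p then Q else {0})" for ij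
  define C where "C = PiE UNIV S \<inter> {f. ?m f \<in> herm_det_ball p \<delta>}"
  have coord: "continuous_on UNIV (\<lambda>f. ?m f $$ (i, j))" if "i < p" "j < p" for i j
    using that continuous_on_product_coordinates[of "(i, j)"] by simp
  have "compactin (product_topology (\<lambda>_. euclidean) UNIV) (PiE UNIV S)"
    unfolding compactin_PiE by (simp add: S_def Q)
  then have compact: "compact (PiE UNIV S)"
    unfolding euclidean_product_topology by simp
  have herm: "hermitian_mat (?m f) \<longleftrightarrow> (\<forall>i<p. \<forall>j<p. cnj (f (j, i)) = f (i, j))" for f
    unfolding hermitian_mat_def mat_eq_iff by (auto simp: index_mat_adjoint)
  have "{f. ?m f \<in> herm_det_ball p \<delta>} = (\<Inter>i\<in>{..<p}. \<Inter>j\<in>{..<p}. {f. cnj (f (j, i)) = f (i, j)})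
      \<inter> {f. det (?m f) = 1} \<inter> {f. frob_norm (?m f - 1\<^sub>m p) \<le> \<delta>}"
    unfolding herm_det_ball_def by (auto simp: herm)
  moreover have "closed \<dots>"
    by (intro closed_Int closed_INT ballI closed_Collect_eq closed_Collect_le continuous_intros
        continuous_on_product_coordinates continuous_on_det[of _ p] continuous_on_frob_norm_minus_one coord) auto
  ultimately have "compact C" unfolding C_def using compact by (simp add: compact_Int_closed)
  have repr: "\<exists>f \<in> C. X = ?m f" if X: "X \<in> herm_det_ball p \<delta>" for X
  proof -
    have Xc: "X \<in> carrier_mat p p" and le: "frob_norm (X - 1\<^sub>m p) \<le> \<delta>"
      using X unfolding herm_det_ball_def by auto
    define f where "f ij = (if fst ij < p \<and> snd ij < p then X $$ ij else 0)" for ij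
    have Xf: "X = ?m f" by (rule eq_matI) (use carrier_matD[OF Xc] in \<open>auto simp: f_def\<close>)
    have "cmod (X $$ (i, j)) \<le> \<delta> + 1" if "i < p" "j < p" for i j
    proof -
      have "cmod ((X - 1\<^sub>m p) $$ (i, j)) \<le> \<delta>"
        using cmod_index_le_frob[of i "X - 1\<^sub>m p" j] le that carrier_matD[OF Xc] by simp
      moreover have "X $$ (i, j) = (X - 1\<^sub>m p) $$ (i, j) + (if i = j then 1 else 0)"
        using that carrier_matD[OF Xc] by simp
      moreover have "cmod (if i = j then 1 else 0) \<le> 1" by simp
      ultimately show ?thesis by (metis add_mono norm_triangle_le)
    qed
    then have "f \<in> PiE UNIV S" by (auto simp: PiE_def f_def S_def inQ)
    then show ?thesis using X Xf unfolding C_def by blast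
  qed
  have "1\<^sub>m p \<in> herm_det_ball p \<delta>"
  proof -
    have "(\<Sum>i<p. \<Sum>j<p. (cmod (1\<^sub>m p $$ (i, j) - (if i = j then 1 else 0)))\<^sup>2) = 0"
      by (intro sum.neutral ballI) auto
    then have "frob_norm (1\<^sub>m p - 1\<^sub>m p) = 0" using frob_norm_minus_one[of "1\<^sub>m p" p] by simp
    then show ?thesis unfolding herm_det_ball_def using \<delta> by (simp add: hermitian_mat_def mat_adjoint_one)
  qed
  then have "C \<noteq> {}" using repr by blast
  then obtain f where f: "f \<in> C" "\<And>g. g \<in> C \<Longrightarrow> F (?m f) \<le> F (?m g)"
    using continuous_attains_inf[OF \<open>compact C\<close> _ continuous_on_subset[OF cont]] by blast
  then show ?thesis using repr unfolding C_def by blast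
qed

section \<open>Algebra of matrices diagonal in a common unitary basis\<close>

lemma unitary_diag_mult:
  assumes U: "unitary_mat n U"
  shows "(U * mat_diag n d * mat_adjoint U) * (U * mat_diag n e * mat_adjoint U)
    = U * mat_diag n (\<lambda>i. d i * e i) * mat_adjoint U"
proof -
  note u = carrier_matD[OF unitary_matD(1)[OF U]]
  have "(U * mat_diag n d * mat_adjoint U) * (U * mat_diag n e * mat_adjoint U)
      = U * (mat_diag n d * (mat_adjoint U * (U * (mat_diag n e * mat_adjoint U))))"
    using u by (simp add: mat_mult_assoc_dim dim_mat_diag del: assoc_mult_mat)
  also have "mat_adjoint U * (U * (mat_diag n e * mat_adjoint U)) = mat_diag n e * mat_adjoint U"
    by (rule unitary_mult_cancel(1)[OF U]) (simp add: dim_mat_diag)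
  also have "U * (mat_diag n d * (mat_diag n e * mat_adjoint U)) = U * (mat_diag n d * mat_diag n e) * mat_adjoint U"
    using u by (simp add: mat_mult_assoc_dim dim_mat_diag del: assoc_mult_mat mat_diag_diag)
  finally show ?thesis unfolding mat_diag_diag .
qed

lemma mat_adjoint_unitary_diag:
  assumes U: "unitary_mat n U"
  shows "mat_adjoint (U * mat_diag n d * mat_adjoint U) = U * mat_diag n (\<lambda>i. cnj (d i)) * mat_adjoint U"
  unfolding mat_adjoint_sandwich[OF unitary_matD(1)[OF U] mat_diag_dim unitary_matD(2)[OF U]]
    mat_adjoint_adjoint mat_adjoint_mat_diag ..

lemma det_unitary_diag:
  assumes U: "unitary_mat n U"
  shows "det (U * mat_diag n (\<lambda>i. complex_of_real (x i)) * mat_adjoint U) = complex_of_real (\<Prod>i<n. x i)"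
  unfolding det_unitary_sandwich[OF U mat_diag_dim] det_mat_diag by simp

lemma hermitian_unitary_diag:
  assumes U: "unitary_mat n U"
  shows "hermitian_mat (U * mat_diag n (\<lambda>i. complex_of_real (x i)) * mat_adjoint U)"
  unfolding hermitian_mat_def mat_adjoint_unitary_diag[OF U] by simp

lemma frob_norm_unitary_diag_minus_one:
  assumes U: "unitary_mat n U"
  shows "frob_norm (U * mat_diag n (\<lambda>i. complex_of_real (x i)) * mat_adjoint U - 1\<^sub>m n)
    = sqrt (\<Sum>i<n. (x i - 1)\<^sup>2)"
proof -
  have "frob_norm (U * mat_diag n (\<lambda>i. complex_of_real (x i)) * mat_adjoint U - 1\<^sub>m n)
      = sqrt (\<Sum>i<n. (cmod (complex_of_real (x i) - 1))\<^sup>2)"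
    unfolding unitary_diag_one[OF U, symmetric] unitary_diag_diff[OF U]
      frob_norm_unitary_sandwich[OF U mat_diag_dim] frob_norm_mat_diag ..
  also have "(\<Sum>i<n. (cmod (complex_of_real (x i) - 1))\<^sup>2) = (\<Sum>i<n. (x i - 1)\<^sup>2)"
  proof (intro sum.cong refl)
    fix i
    have eq: "complex_of_real (x i) - 1 = complex_of_real (x i - 1)" by simp
    show "(cmod (complex_of_real (x i) - 1))\<^sup>2 = (x i - 1)\<^sup>2"
      unfolding eq norm_of_real power2_abs ..
  qed
  finally show ?thesis .
qed

text \<open>Stretching one eigendirection by t and another by 1/t preserves the determinant. At t =
  1 the matrix is L* L, strictly inside the ball, so by continuity the perturbed matrices stay
  inside for t near 1.\<close>

lemma herm_det_ball_perturb:
  assumes L: "L \<in> carrier_mat p p" "det L = 1" and lt: "frob_norm (mat_adjoint L * L - 1\<^sub>m p) < \<delta>"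
    and U: "unitary_mat p U" and ab: "a < p" "b < p" "a \<noteq> b"
  defines "T \<equiv> \<lambda>t l. if l = a then t else if l = b then 1 / t else (1 :: real)"
  shows "\<exists>\<eta>>0. \<forall>t. 1 < t \<and> t < 1 + \<eta> \<longrightarrow>
    mat_adjoint L * (U * mat_diag p (\<lambda>l. complex_of_real (T t l)) * mat_adjoint U) * L \<in> herm_det_ball p \<delta>"
proof -
  note u = unitary_matD[OF U] and L' = mat_adjoint_carrier[OF L(1)]
  define P where "P = mat_adjoint L * U"
  have P: "P \<in> carrier_mat p p" unfolding P_def by (rule mult_carrier_mat[OF L' u(1)])
  define M where "M t = P * mat_diag p (\<lambda>l. complex_of_real (T t l)) * mat_adjoint P" for t
  have M: "M t \<in> carrier_mat p p" for t
    unfolding M_def by (rule mult_carrier_mat[OF mult_carrier_mat[OF P mat_diag_dim] mat_adjoint_carrier[OF P]])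
  have MT: "mat_adjoint L * (U * mat_diag p (\<lambda>l. complex_of_real (T t l)) * mat_adjoint U) * L = M t" for t
    using sandwich_sandwich[OF L' u(1) mat_diag_dim[of p "\<lambda>l. complex_of_real (T t l)"]]
    unfolding M_def P_def mat_adjoint_adjoint .
  have prodT: "(\<Prod>l<p. T t l) = 1" if "1 < t" for t
  proof -
    have "(\<Prod>l<p. T t l) = T t a * (T t b * (\<Prod>l\<in>{..<p} - {a} - {b}. T t l))"
      using ab by (subst prod.remove[of _ a]; simp; subst prod.remove[of _ b]; simp)
    also have "(\<Prod>l\<in>{..<p} - {a} - {b}. T t l) = 1" by (rule prod.neutral) (simp add: T_def)
    finally show ?thesis using ab that by (simp add: T_def)
  qed
  have detM: "det (M t) = 1" if "1 < t" for t
  proof -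
    have UD: "U * mat_diag p (\<lambda>l. complex_of_real (T t l)) * mat_adjoint U \<in> carrier_mat p p"
      by (rule unitary_sandwich_carrier[OF U mat_diag_dim])
    show ?thesis
      unfolding MT[symmetric] det_mult[OF mult_carrier_mat[OF L' UD] L(1)] det_mult[OF L' UD]
        det_unitary_diag[OF U] prodT[OF that] det_mat_adjoint[OF L(1)] L(2) by simp
  qed
  have hM: "hermitian_mat (M t)" for t
    unfolding M_def by (rule hermitian_sandwich[OF P mat_diag_dim]) (simp add: hermitian_mat_def mat_adjoint_mat_diag)
  \<comment> \<open>Continuity is wanted at t = 1 only; the open half-line keeps 1/t away from its
    singularity.\<close>
  have "continuous_on {0<..} (\<lambda>t. T t l)" for l
    unfolding T_def by (cases "l = a"; cases "l = b") (auto intro!: continuous_intros)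
  then have "continuous_on {0<..} (\<lambda>t. M t $$ (i, j))" if "i < p" "j < p" for i j
    unfolding M_def index_diag_sandwich[OF P that] by (intro continuous_intros)
  then have "continuous_on {0<..} (\<lambda>t. frob_norm (M t - 1\<^sub>m p))"
    by (rule continuous_on_frob_norm_minus_one[OF M])
  then have "isCont (\<lambda>t. frob_norm (M t - 1\<^sub>m p)) 1"
    by (simp add: continuous_on_eq_continuous_at)
  moreover have "M 1 = mat_adjoint L * L"
  proof -
    have "(\<lambda>l. complex_of_real (T 1 l)) = (\<lambda>_. 1)" unfolding T_def by auto
    then show ?thesis
      unfolding MT[symmetric] by (simp only: unitary_diag_one[OF U] right_mult_one_mat[OF L'])
  qed
  ultimately have "\<forall>\<^sub>F t in at 1. frob_norm (M t - 1\<^sub>m p) < \<delta>"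
    using lt by (intro order_tendstoD(2)[of _ "frob_norm (M 1 - 1\<^sub>m p)"]) (simp_all add: isCont_def)
  then obtain \<eta> where \<eta>: "0 < \<eta>" "\<And>t. t \<noteq> 1 \<Longrightarrow> dist t 1 < \<eta> \<Longrightarrow> frob_norm (M t - 1\<^sub>m p) < \<delta>"
    unfolding eventually_at by blast
  show ?thesis
  proof (intro exI[of _ \<eta>] conjI allI impI \<eta>(1))
    fix t assume "1 < t \<and> t < 1 + \<eta>"
    then show "mat_adjoint L * (U * mat_diag p (\<lambda>l. complex_of_real (T t l)) * mat_adjoint U) * L \<in> herm_det_ball p \<delta>"
      unfolding MT herm_det_ball_def using M hM detM \<eta>(2)[of t] by (simp add: dist_real_def)
  qed
qed

text \<open>Trace duality, tr \<Phi>(X) = tr (\<Phi>*(1) X), read in an eigenbasis \<open>U\<close>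
  of \<Phi>*(1). The output basis does not affect the trace and is taken standard; each
  \<open>c l\<close> is then a column sum of weights.\<close>

lemma kraus_dual_eigenvalues:
  assumes Bs: "set Bs \<subseteq> carrier_mat n p" and U: "unitary_mat p U"
    and dual: "kraus_dual p Bs (1\<^sub>m n) = U * mat_diag p (\<lambda>l. complex_of_real (c l)) * mat_adjoint U"
  shows "l < p \<Longrightarrow> 0 \<le> c l"
    and "mat_trace (kraus_map n Bs (U * mat_diag p (\<lambda>l. complex_of_real (d l)) * mat_adjoint U))
      = complex_of_real (\<Sum>l<p. c l * d l)"
proof -
  note u = unitary_matD[OF U]
  let ?I = "1\<^sub>m n :: complex mat"
  let ?Cs = "map (\<lambda>A. mat_adjoint ?I * A * U) Bs"
  note Cs = conj_kraus_carrier[OF Bs u(1) one_carrier_mat]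
  have "kraus_dual p ?Cs (mat_diag n (\<lambda>_. 1)) = mat_diag p (\<lambda>l. complex_of_real (c l))"
    unfolding kraus_dual_conj[OF Bs u(1) one_carrier_mat mat_diag_dim] unitary_diag_one[OF unitary_mat_one] dual
    by (rule unitary_sandwich_cancel(1)[OF U mat_diag_dim])
  then have c: "c l = (\<Sum>k<n. kraus_weight ?Cs k l)" if "l < p" for l
  proof -
    assume "kraus_dual p ?Cs (mat_diag n (\<lambda>_. 1)) = mat_diag p (\<lambda>l. complex_of_real (c l))"
    then have "complex_of_real (c l) = kraus_dual p ?Cs (mat_diag n (\<lambda>_. 1)) $$ (l, l)"
      using that by (simp add: mat_diag_def)
    also have "\<dots> = complex_of_real (\<Sum>k<n. kraus_weight ?Cs k l)"
      unfolding kraus_dual_diag_index[OF Cs that] by simp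
    finally show ?thesis unfolding of_real_eq_iff .
  qed
  show "0 \<le> c l" if "l < p" unfolding c[OF that] by (intro sum_nonneg kraus_weight_nonneg)
  let ?D = "mat_diag p (\<lambda>l. complex_of_real (d l))"
  have "kraus_map n ?Cs ?D = mat_adjoint ?I * kraus_map n Bs (U * ?D * mat_adjoint U) * ?I"
    by (rule kraus_map_conj[OF Bs u(1) one_carrier_mat mat_diag_dim])
  also have "\<dots> = kraus_map n Bs (U * ?D * mat_adjoint U)"
    by (simp only: mat_adjoint_one left_mult_one_mat[OF kraus_map_carrier] right_mult_one_mat[OF kraus_map_carrier])
  finally have "mat_trace (kraus_map n Bs (U * ?D * mat_adjoint U)) = mat_trace (kraus_map n ?Cs ?D)"
    by (simp only:)
  also have "\<dots> = (\<Sum>k<n. \<Sum>l<p. of_real (kraus_weight ?Cs k l) * complex_of_real (d l))"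
    unfolding mat_trace_def
    by (intro sum.cong kraus_map_diag_index[OF Cs]) (simp_all add: kraus_map_def)
  also have "\<dots> = (\<Sum>l<p. \<Sum>k<n. of_real (kraus_weight ?Cs k l) * complex_of_real (d l))"
    by (rule sum.swap)
  also have "\<dots> = complex_of_real (\<Sum>l<p. c l * d l)"
    by (simp add: c sum_distrib_right)
  finally show "mat_trace (kraus_map n Bs (U * ?D * mat_adjoint U)) = complex_of_real (\<Sum>l<p. c l * d l)" .
qed

text \<open>The comparison of two dual eigenvalues carries a factor t > 1, which disappears only in
  the limit from the right.\<close>

lemma le_of_le_mult_near_one:
  fixes x y :: real
  assumes "0 < \<eta>" and "\<And>t. 1 < t \<Longrightarrow> t < 1 + \<eta> \<Longrightarrow> y \<le> x * t"
  shows "y \<le> x"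
proof (rule tendsto_lowerbound)
  show "((\<lambda>t. x * t) \<longlongrightarrow> x) (at_right 1)"
    by (rule tendsto_eq_intros refl)+ simp
  have "\<forall>\<^sub>F t in at_right (1 :: real). t \<in> {1<..<1 + \<eta>}"
    using assms(1) by (intro eventually_at_right_real) simp
  then show "\<forall>\<^sub>F t in at_right (1 :: real). y \<le> x * t"
    by (rule eventually_mono) (use assms(2) in auto)
qed simp

section \<open>Optimality conditions\<close>

lemma invertible_mat_det_one:
  fixes A :: "complex mat"
  assumes A: "A \<in> carrier_mat n n" and "det A = 1"
  shows "invertible_mat A"
proof -
  have "(1 :: complex) \<cdot>\<^sub>m 1\<^sub>m n = 1\<^sub>m n" by (rule eq_matI) auto
  then have "A * adj_mat A = 1\<^sub>m n" "adj_mat A * A = 1\<^sub>m n" "adj_mat A \<in> carrier_mat n n"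
    using adj_mat[OF A] assms(2) by simp_all
  then show ?thesis
    using carrier_matD[OF A] unfolding invertible_mat_def inverts_mat_def
    by (intro conjI exI[of _ "adj_mat A"]) simp_all
qed

text \<open>Explains the radius 1/3 of the ball: at x = 2/3 the bound 1 - 1/x \<le> ln x gives
  exactly -1/2, the range of exponents allowed in \<open>scaling_exponents_small\<close>.\<close>

lemma abs_minus_one_le_ln:
  fixes x :: real
  assumes "\<bar>x - 1\<bar> \<le> 1 / 3"
  shows "\<bar>x - 1\<bar> \<le> 2 * \<bar>ln x\<bar>" "\<bar>ln x\<bar> \<le> 1 / 2"
proof -
  have x: "2 / 3 \<le> x" "x \<le> 4 / 3" using assms abs_ge_self[of "x - 1"] abs_ge_minus_self[of "x - 1"] by linarith+
  have up: "ln x \<le> x - 1" using ln_le_minus_one[of x] x by simp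
  have low: "1 - 1 / x \<le> ln x" using ln_le_minus_one[of "1 / x"] x by (simp add: ln_div)
  have inv: "1 / x \<le> 3 / 2" using x by (simp add: field_simps)
  show "\<bar>ln x\<bar> \<le> 1 / 2" using up low inv x by (simp add: abs_le_iff)
  show "\<bar>x - 1\<bar> \<le> 2 * \<bar>ln x\<bar>"
  proof (cases "1 \<le> x")
    case True
    have "(x - 1) / 2 \<le> 1 - 1 / x"
    proof -
      have "0 \<le> (x - 1) * (2 - x) / (2 * x)" using True x by simp
      also have "\<dots> = 1 - 1 / x - (x - 1) / 2" using x by (simp add: field_simps power2_eq_square)
      finally show ?thesis by simp
    qed
    then show ?thesis using low True by simp
  next
    case False
    then show ?thesis using up by simp
  qed
qed

text \<open>The matrix R must be sqrt g times the inverse square root of \<Phi> X. It has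
  determinant one exactly when g is the geometric mean of the eigenvalues of \<Phi> X, which
  therefore obeys the same bounds as they do.\<close>

lemma geometric_mean_bounds:
  fixes m :: "nat \<Rightarrow> real"
  assumes n: "1 \<le> n" and lo: "0 < lo" and m: "\<And>k. k < n \<Longrightarrow> lo \<le> m k \<and> m k \<le> hi"
  shows "\<exists>g. lo \<le> g \<and> g \<le> hi \<and> g ^ n = (\<Prod>k<n. m k)"
proof (intro exI[of _ "root n (\<Prod>k<n. m k)"] conjI)
  have hi: "0 < hi" using m[of 0] n lo by linarith
  have pos: "0 \<le> (\<Prod>k<n. m k)" using m lo by (intro prod_nonneg) force
  show pow: "root n (\<Prod>k<n. m k) ^ n = (\<Prod>k<n. m k)" using n pos by simp
  have "(\<Prod>k<n. lo) \<le> (\<Prod>k<n. m k)" using m lo by (intro prod_mono) auto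
  then have "root n (lo ^ n) \<le> root n (\<Prod>k<n. m k)" using n by (intro real_root_le_mono) auto
  then show "lo \<le> root n (\<Prod>k<n. m k)" using n lo by (simp add: real_root_power_cancel)
  have "(\<Prod>k<n. m k) \<le> (\<Prod>k<n. hi)" using m lo by (intro prod_mono) force
  then have "root n (\<Prod>k<n. m k) \<le> root n (hi ^ n)" using n by (intro real_root_le_mono) auto
  then show "root n (\<Prod>k<n. m k) \<le> hi" using n hi by (simp add: real_root_power_cancel)
qed

text \<open>Both numbers lie in an interval of length 4 * \<theta> * q, and m is at least q/2
  because (3/4)^2 exceeds 1/2; the quotient gives 8 * \<theta>.\<close>

lemma ratio_close_to_one:
  fixes q \<theta> g m :: real
  assumes q: "0 < q" and th: "0 \<le> \<theta>" "\<theta> \<le> 1 / 4"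
    and g: "q * (1 - \<theta>)\<^sup>2 \<le> g" "g \<le> q * (1 + \<theta>)\<^sup>2" and m: "q * (1 - \<theta>)\<^sup>2 \<le> m" "m \<le> q * (1 + \<theta>)\<^sup>2"
  shows "\<bar>1 - g / m\<bar> \<le> 8 * \<theta>"
proof -
  have half: "1 / 2 \<le> (1 - \<theta>)\<^sup>2"
  proof -
    have "(3 / 4)\<^sup>2 \<le> (1 - \<theta>)\<^sup>2" using th by (intro power_mono) auto
    then show ?thesis by (simp add: power2_eq_square)
  qed
  then have "q * (1 / 2) \<le> q * (1 - \<theta>)\<^sup>2" using q by (intro mult_left_mono) auto
  then have m2: "q / 2 \<le> m" using m(1) by simp
  have m0: "0 < m" using m2 q by linarith
  have "q * (1 + \<theta>)\<^sup>2 - q * (1 - \<theta>)\<^sup>2 = 4 * \<theta> * q" by (simp add: power2_eq_square algebra_simps)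
  then have "\<bar>m - g\<bar> \<le> 4 * \<theta> * q" using g m by (simp add: abs_le_iff)
  also have "\<dots> \<le> 8 * \<theta> * m" using mult_left_mono[OF m2, of "8 * \<theta>"] th by simp
  finally have "\<bar>m - g\<bar> / m \<le> 8 * \<theta>" using m0 by (simp add: field_simps)
  moreover have "1 - g / m = (m - g) / m" using m0 by (simp add: field_simps)
  ultimately show ?thesis using m0 by simp
qed

lemma frob_norm_swap_minus:
  assumes "A \<in> carrier_mat n n" "B \<in> carrier_mat n n"
  shows "frob_norm (A - B) = frob_norm (B - A)"
proof -
  have "(\<Sum>i<n. \<Sum>j<n. (cmod ((A - B) $$ (i, j)))\<^sup>2) = (\<Sum>i<n. \<Sum>j<n. (cmod ((B - A) $$ (i, j)))\<^sup>2)"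
    using carrier_matD[OF assms(1)] carrier_matD[OF assms(2)]
    by (intro sum.cong) (auto simp: norm_minus_commute)
  then show ?thesis
    unfolding frob_norm_def using carrier_matD[OF assms(1)] carrier_matD[OF assms(2)] by simp
qed

text \<open>At a constrained minimum of \<open>det (\<Phi> X)\<close> the eigenvalues of the scaled dual at the identity
  coincide: otherwise multiplying one eigendirection by \<open>t\<close> and dividing another by \<open>t\<close> lowers the trace
  of the scaled map at the identity, hence by the AM-GM inequality its determinant.\<close>

lemma balanced_dual_at_minimum:
  assumes As: "set As \<subseteq> carrier_mat n p" and p: "1 \<le> p" and n: "1 \<le> n"
    and L: "L \<in> carrier_mat p p" "det L = 1" and R: "R \<in> carrier_mat n n" "det R = 1"
    and lt: "frob_norm (mat_adjoint L * L - 1\<^sub>m p) < \<delta>"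
    and min: "\<And>Y. Y \<in> herm_det_ball p \<delta> \<Longrightarrow> g ^ n \<le> Re (det (kraus_map n As Y))"
    and g: "0 < g"
    and one: "R * kraus_map n As (mat_adjoint L * L) * mat_adjoint R = complex_of_real g \<cdot>\<^sub>m 1\<^sub>m n"
  shows "op_norm_mat (kraus_dual p (map (\<lambda>A. R * A * mat_adjoint L) As) (1\<^sub>m n)
    - complex_of_real (real n * g / real p) \<cdot>\<^sub>m 1\<^sub>m p) \<le> 0"
proof -
  define Bs where "Bs = map (\<lambda>A. R * A * mat_adjoint L) As"
  have Bs: "set Bs \<subseteq> carrier_mat n p"
  proof -
    have "R * A * mat_adjoint L \<in> carrier_mat n p" if "A \<in> set As" for A
      by (rule mult_carrier_mat[OF mult_carrier_mat[OF R(1) subsetD[OF As that]] mat_adjoint_carrier[OF L(1)]])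
    then show ?thesis unfolding Bs_def by (simp add: image_subset_iff)
  qed
  have "hermitian_mat (kraus_dual p Bs (1\<^sub>m n))"
  proof -
    have "set (map mat_adjoint Bs) \<subseteq> carrier_mat p n"
      unfolding set_map using Bs mat_adjoint_carrier by blast
    moreover have "hermitian_mat (1\<^sub>m n)" unfolding hermitian_mat_def by (rule mat_adjoint_one)
    ultimately show ?thesis unfolding kraus_dual_eq_kraus_map by (intro hermitian_kraus_map[where p = n]) simp_all
  qed
  then obtain U c where U: "unitary_mat p U"
    and dual: "kraus_dual p Bs (1\<^sub>m n) = U * mat_diag p (\<lambda>l. complex_of_real (c l)) * mat_adjoint U"
    by (rule hermitian_spectralE[OF kraus_dual_carrier])
  note u = unitary_matD[OF U]
  note c0 = kraus_dual_eigenvalues(1)[OF Bs U dual] and tr = kraus_dual_eigenvalues(2)[OF Bs U dual]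
  have map_Bs: "kraus_map n Bs X = R * kraus_map n As (mat_adjoint L * X * L) * mat_adjoint R"
    if "X \<in> carrier_mat p p" for X
    unfolding Bs_def by (rule kraus_map_scaled[OF As L(1) R(1) that])
  have csum: "(\<Sum>l<p. c l) = n * g"
  proof -
    have "kraus_map n Bs (U * mat_diag p (\<lambda>l. complex_of_real 1) * mat_adjoint U)
        = complex_of_real g \<cdot>\<^sub>m 1\<^sub>m n"
      unfolding of_real_1 unitary_diag_one[OF U] map_Bs[OF one_carrier_mat]
        right_mult_one_mat[OF mat_adjoint_carrier[OF L(1)]] by (rule one)
    then have "complex_of_real (\<Sum>l<p. c l) = mat_trace (complex_of_real g \<cdot>\<^sub>m 1\<^sub>m n)"
      using tr[of "\<lambda>_. 1"] by simp
    also have "\<dots> = complex_of_real (n * g)" by (simp add: mat_trace_def)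
    finally show ?thesis unfolding of_real_eq_iff .
  qed
  have le: "c b \<le> c a" if ab: "a < p" "b < p" "a \<noteq> b" for a b
  proof -
    let ?T = "\<lambda>t l. if l = a then t else if l = b then 1 / t else (1 :: real)"
    obtain \<eta> where \<eta>: "0 < \<eta>" and in_ball: "\<And>t. 1 < t \<Longrightarrow> t < 1 + \<eta> \<Longrightarrow>
        mat_adjoint L * (U * mat_diag p (\<lambda>l. complex_of_real (?T t l)) * mat_adjoint U) * L \<in> herm_det_ball p \<delta>"
      using herm_det_ball_perturb[OF L lt U ab] by blast
    have "c b \<le> c a * t" if t: "1 < t" "t < 1 + \<eta>" for t
    proof -
      define X where "X = U * mat_diag p (\<lambda>l. complex_of_real (?T t l)) * mat_adjoint U"
      have X: "X \<in> carrier_mat p p" unfolding X_def by (rule unitary_sandwich_carrier[OF U mat_diag_dim])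
      have trX: "mat_trace (kraus_map n Bs X) = complex_of_real (\<Sum>l<p. c l * ?T t l)"
        unfolding X_def by (rule tr)
      have RK: "R * kraus_map n As Y \<in> carrier_mat n n" for Y
        by (rule mult_carrier_mat[OF R(1) kraus_map_carrier])
      \<comment> \<open>\<open>L\<close> and \<open>R\<close> have determinant one, so minimality of
        the original determinant carries over to the scaled map, now with its minimum at the
        identity.\<close>
      have "det (kraus_map n Bs X) = det (kraus_map n As (mat_adjoint L * X * L))"
        unfolding map_Bs[OF X] det_mult[OF RK mat_adjoint_carrier[OF R(1)]] det_mult[OF R(1) kraus_map_carrier]
          det_mat_adjoint[OF R(1)] R(2) by simp
      then have "g ^ n \<le> Re (det (kraus_map n Bs X))"
        using min[OF in_ball[OF t, folded X_def]] by simp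
      also have "\<dots> \<le> (Re (mat_trace (kraus_map n Bs X)) / n) ^ n"
        by (rule det_kraus_le_trace[OF Bs n U _ X_def]) (use t in auto)
      finally have "g ^ n \<le> ((\<Sum>l<p. c l * ?T t l) / n) ^ n" unfolding trX Re_complex_of_real .
      moreover have "0 \<le> (\<Sum>l<p. c l * ?T t l)"
        using t c0 by (intro sum_nonneg mult_nonneg_nonneg) auto
      ultimately have "g \<le> (\<Sum>l<p. c l * ?T t l) / n"
        using n g by (intro power_mono_iff[THEN iffD1, of g _ n]) auto
      \<comment> \<open>By \<open>csum\<close> the left side is n g, the trace at the identity: the
        perturbation cannot lower the trace. Only the summands at a and b change, which leaves an
        inequality between \<open>c a\<close> and \<open>c b\<close>.\<close>
      then have "(\<Sum>l<p. c l) \<le> (\<Sum>l<p. c l * ?T t l)"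
        unfolding csum using n by (simp add: field_simps)
      moreover have "(\<Sum>l<p. h l) = h a + (h b + (\<Sum>l\<in>{..<p} - {a} - {b}. h l))" for h :: "nat \<Rightarrow> real"
        using ab by (simp add: sum.remove[of _ a] sum.remove[of _ b])
      moreover have "(\<Sum>l\<in>{..<p} - {a} - {b}. c l * ?T t l) = (\<Sum>l\<in>{..<p} - {a} - {b}. c l)"
        by (intro sum.cong) auto
      ultimately have "c a + c b \<le> c a * t + c b * (1 / t)" using ab by simp
      then have "(t - 1) * (c b / t) \<le> (t - 1) * c a" using t by (simp add: field_simps)
      then have "c b / t \<le> c a" by (rule mult_left_le_imp_le) (use t in simp)
      then show ?thesis using t by (simp add: field_simps)
    qed
    then show ?thesis by (rule le_of_le_mult_near_one[OF \<eta>])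
  qed
  have ceq: "c l = n * g / p" if l: "l < p" for l
  proof -
    \<comment> \<open>\<open>le\<close> holds for both orders of the two indices, so all dual
      eigenvalues agree; their value is fixed by their sum.\<close>
    have "c i = c l" if "i < p" for i using le[of i l] le[of l i] that l by (cases "i = l") auto
    then have "(\<Sum>i<p. c i) = p * c l" by simp
    then show ?thesis using csum p by (simp add: field_simps)
  qed
  show ?thesis
    unfolding Bs_def[symmetric] dual unitary_diag_minus_scalar[OF U]
    by (rule op_norm_unitary_diag_le[OF U]) (simp_all add: ceq)
qed

section \<open>Construction of the scaling for maps of positive size\<close>

lemma prod_sqrt: "(\<Prod>i<n. sqrt (f i)) = sqrt (\<Prod>i<n. f i)" for n :: nat
  by (induction n) (simp_all add: real_sqrt_mult)

lemma expander_scaling: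
  fixes \<Phi> :: "complex mat \<Rightarrow> complex mat"
  assumes p: "1 \<le> p" and n: "1 \<le> n" and rep: "kraus_rep p n \<Phi> As"
    and e0: "0 \<le> \<epsilon>" and lam: "0 < lam" "lam \<le> 1"
    and exp: "quantum_expander p n \<epsilon> (1 - lam) \<Phi>"
    and small: "\<epsilon> * sqrt p / lam \<le> 1 / 100" and s: "0 < map_size p \<Phi>"
  shows "\<exists>L R. L \<in> carrier_mat p p \<and> R \<in> carrier_mat n n \<and> det L = 1 \<and> det R = 1 \<and>
    doubly_balanced p n (scaling \<Phi> L R) \<and>
    frob_norm (1\<^sub>m p - mat_adjoint L * L) \<le> 200 * (\<epsilon> * sqrt p / lam) \<and>
    op_norm_mat (1\<^sub>m n - mat_adjoint R * R) \<le> 200 * (\<epsilon> * sqrt p / lam)"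
proof -
  define s where "s = map_size p \<Phi>"
  define \<tau> where "\<tau> = \<epsilon> * sqrt p / lam"
  \<comment> \<open>24 = 2 * 12: the exponents are bounded by 12 * \<tau>, and passing from ln x to
    x - 1 costs a factor 2.\<close>
  define \<theta> where "\<theta> = 24 * \<tau>"
  have s0: "0 < s" unfolding s_def by (rule s)
  have As: "set As \<subseteq> carrier_mat n p" and \<Phi>: "\<And>Y. Y \<in> carrier_mat p p \<Longrightarrow> \<Phi> Y = kraus_map n As Y"
    using rep unfolding kraus_rep_def by auto
  \<comment> \<open>Since sqrt p is at least 1, \<epsilon> is controlled by \<tau> * lam. Smallness
    of \<tau> then gives both \<epsilon> \<le> lam/2 and \<epsilon> \<le> \<theta>.\<close>
  have et: "\<epsilon> \<le> \<tau> * lam"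
    using mult_left_mono[of 1 "sqrt p" \<epsilon>] e0 p lam unfolding \<tau>_def by simp
  have t0: "0 \<le> \<tau>" unfolding \<tau>_def using e0 lam by simp
  have t1: "\<tau> \<le> 1 / 100" unfolding \<tau>_def by (rule small)
  have el: "\<epsilon> \<le> lam / 2" using et mult_right_mono[OF t1, of lam] lam by linarith
  have th: "0 \<le> \<theta>" "\<theta> \<le> 1 / 4" unfolding \<theta>_def using t0 t1 by auto
  have eth: "\<epsilon> \<le> \<theta>" using et mult_left_mono[OF lam(2) t0] t0 unfolding \<theta>_def by linarith

  define F where "F X = Re (det (kraus_map n As X))" for X
  have "continuous_on UNIV (\<lambda>f. F (mat p p f))"
    unfolding F_def
    by (intro continuous_on_Re continuous_on_det[of _ n] continuous_on_kraus_map_index[OF As])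
      (use continuous_on_product_coordinates in auto)
  from herm_det_ball_minimum[OF this, of "1 / 3"]
  obtain X where X: "X \<in> herm_det_ball p (1 / 3)"
    and min: "\<And>Y. Y \<in> herm_det_ball p (1 / 3) \<Longrightarrow> F X \<le> F Y" by auto
  have Xc: "X \<in> carrier_mat p p" and Xh: "hermitian_mat X" and Xd: "det X = 1"
    and Xf: "frob_norm (X - 1\<^sub>m p) \<le> 1 / 3" using X unfolding herm_det_ball_def by auto
  obtain U x where U: "unitary_mat p U"
    and Xx: "X = U * mat_diag p (\<lambda>l. complex_of_real (x l)) * mat_adjoint U"
    by (rule hermitian_spectralE[OF Xc Xh])
  obtain V m where V: "unitary_mat n V"
    and Km: "kraus_map n As X = V * mat_diag n (\<lambda>k. complex_of_real (m k)) * mat_adjoint V"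
    by (rule hermitian_spectralE[OF kraus_map_carrier hermitian_kraus_map[OF As Xc Xh]])
  define b where "b = kraus_weight (map (\<lambda>A. mat_adjoint V * A * U) As)"
  note w = quantum_expander_weights[OF rep exp U V, folded b_def s_def]
  have mb: "m k = (\<Sum>l<p. b k l * x l)" if "k < n" for k
    unfolding b_def by (rule kraus_eigenvalues[OF As U V Km[unfolded Xx] that])
  have frobX: "frob_norm (X - 1\<^sub>m p) = sqrt (\<Sum>l<p. (x l - 1)\<^sup>2)"
    unfolding Xx by (rule frob_norm_unitary_diag_minus_one[OF U])
  have dist_le: "\<bar>x l - 1\<bar> \<le> frob_norm (X - 1\<^sub>m p)" if "l < p" for l
  proof -
    have "(x l - 1)\<^sup>2 \<le> (\<Sum>l<p. (x l - 1)\<^sup>2)"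
      using that by (intro member_le_sum) auto
    then have "sqrt ((x l - 1)\<^sup>2) \<le> sqrt (\<Sum>l<p. (x l - 1)\<^sup>2)" by (rule real_sqrt_le_mono)
    then show ?thesis unfolding frobX by simp
  qed
  have x1: "\<bar>x l - 1\<bar> \<le> 1 / 3" if "l < p" for l using dist_le[OF that] Xf by simp
  have x0: "0 < x l" if "l < p" for l using x1[OF that] by linarith
  have prodx: "(\<Prod>l<p. x l) = 1"
    using Xd unfolding Xx det_unitary_diag[OF U] by (simp only: of_real_eq_1_iff)
  define z where "z l = ln (x l)" for l
  have ez: "exp (z l) = x l" if "l < p" for l unfolding z_def using x0[OF that] by simp

  have "sqrt (\<Sum>l<p. (z l)\<^sup>2) \<le> 12 * (\<epsilon> * sqrt p / lam)"
  proof (rule scaling_exponents_small[OF p n s0 e0 el lam _ w(1)])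
    show "0 \<le> b k l" for k l unfolding b_def by (rule kraus_weight_nonneg)
    show "\<bar>(\<Sum>l<p. b k l) - s / n\<bar> \<le> s * \<epsilon> / n" if "k < n" for k by (rule w(2)[OF that])
    show "\<bar>(\<Sum>k<n. b k l) - s / p\<bar> \<le> s * \<epsilon> / p" if "l < p" for l by (rule w(3)[OF that])
    have "ln (\<Prod>l<p. x l) = (\<Sum>l<p. z l)"
      unfolding z_def by (rule ln_prod) (use x0 in force)+
    then show z0: "(\<Sum>l<p. z l) = 0" unfolding prodx by simp
    show "sqrt (\<Sum>k<n. (\<Sum>l<p. b k l * z l)\<^sup>2)
        \<le> (1 - lam) * (s / sqrt (real n * real p)) * sqrt (\<Sum>l<p. (z l)\<^sup>2)" by (rule w(4)[OF z0])
    show "\<bar>z l\<bar> \<le> 1 / 2" if "l < p" for l unfolding z_def by (rule abs_minus_one_le_ln(2)[OF x1[OF that]])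
    have "(\<Prod>k<n. \<Sum>l<p. b k l * exp (z l)) = (\<Prod>k<n. m k)"
      by (intro prod.cong) (simp_all add: mb ez)
    also have "\<dots> = F X" unfolding F_def Km det_unitary_diag[OF V] by (simp only: Re_complex_of_real)
    \<comment> \<open>The identity competes for the minimum. Together with AM-GM this is all that
      the a priori estimate uses about minimality.\<close>
    also have "\<dots> \<le> F (1\<^sub>m p)"
    proof (rule min)
      have "frob_norm (1\<^sub>m p - 1\<^sub>m p) = 0"
        using frob_norm_unitary_diag_minus_one[OF U, of "\<lambda>_. 1"] unitary_diag_one[OF U] by simp
      then show "1\<^sub>m p \<in> herm_det_ball p (1 / 3)"
        unfolding herm_det_ball_def by (simp add: hermitian_mat_def mat_adjoint_one)
    qed
    also have "\<dots> \<le> (Re (mat_trace (kraus_map n As (1\<^sub>m p))) / n) ^ n"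
      unfolding F_def
      by (rule det_kraus_le_trace[OF As n U, where x = "\<lambda>_. 1"])
        (simp_all only: of_real_1 unitary_diag_one[OF U] zero_le_one)
    also have "Re (mat_trace (kraus_map n As (1\<^sub>m p))) = s" unfolding s_def map_size_def by (simp add: \<Phi>)
    finally show "(\<Prod>k<n. \<Sum>l<p. b k l * exp (z l)) \<le> (s / n) ^ n" .
  qed
  then have zn: "sqrt (\<Sum>l<p. (z l)\<^sup>2) \<le> 12 * \<tau>" unfolding \<tau>_def .
  have fX: "frob_norm (X - 1\<^sub>m p) \<le> \<theta>"
  proof -
    have "(x l - 1)\<^sup>2 \<le> (2 * z l)\<^sup>2" if "l < p" for l
      using abs_minus_one_le_ln(1)[OF x1[OF that]] unfolding z_def
      by (intro abs_le_square_iff[THEN iffD1]) (simp add: abs_mult)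
    then have "frob_norm (X - 1\<^sub>m p) \<le> sqrt (\<Sum>l<p. (2 * z l)\<^sup>2)"
      unfolding frobX by (intro real_sqrt_le_mono sum_mono) simp
    also have "\<dots> = 2 * sqrt (\<Sum>l<p. (z l)\<^sup>2)"
      by (simp add: power_mult_distrib real_sqrt_mult flip: sum_distrib_left)
    finally show ?thesis using zn unfolding \<theta>_def by simp
  qed
  have xth: "\<bar>x l - 1\<bar> \<le> \<theta>" if "l < p" for l using dist_le[OF that] fX by simp

  \<comment> \<open>One factor 1 \<plusminus> \<theta> comes from the eigenvalues of X, the other
    from the row sums, whose relative error \<epsilon> is at most \<theta>.\<close>
  have mbound: "s / n * (1 - \<theta>)\<^sup>2 \<le> m k \<and> m k \<le> s / n * (1 + \<theta>)\<^sup>2" if k: "k < n" for k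
  proof -
    have bx: "b k l * (1 - \<theta>) \<le> b k l * x l" "b k l * x l \<le> b k l * (1 + \<theta>)" if "l < p" for l
      using xth[OF that] kraus_weight_nonneg unfolding b_def by (auto intro!: mult_left_mono simp: abs_le_iff)
    have "(\<Sum>l<p. b k l) * (1 - \<theta>) \<le> m k" "m k \<le> (\<Sum>l<p. b k l) * (1 + \<theta>)"
      unfolding mb[OF k] sum_distrib_right using bx by (auto intro!: sum_mono)
    moreover have r: "s / n * (1 - \<epsilon>) \<le> (\<Sum>l<p. b k l)" "(\<Sum>l<p. b k l) \<le> s / n * (1 + \<epsilon>)"
      using w(2)[OF k] n by (auto simp: abs_le_iff field_simps)
    moreover have "s / n * (1 - \<theta>) * (1 - \<theta>) \<le> (\<Sum>l<p. b k l) * (1 - \<theta>)"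
    proof (rule mult_right_mono)
      have "s / n * (1 - \<theta>) \<le> s / n * (1 - \<epsilon>)" using s0 eth by (intro mult_left_mono) auto
      with r(1) show "s / n * (1 - \<theta>) \<le> (\<Sum>l<p. b k l)" by simp
    qed (use th in simp)
    moreover have "(\<Sum>l<p. b k l) * (1 + \<theta>) \<le> s / n * (1 + \<theta>) * (1 + \<theta>)"
    proof (rule mult_right_mono)
      have "s / n * (1 + \<epsilon>) \<le> s / n * (1 + \<theta>)" using s0 eth by (intro mult_left_mono) auto
      with r(2) show "(\<Sum>l<p. b k l) \<le> s / n * (1 + \<theta>)" by simp
    qed (use th in simp)
    ultimately show ?thesis by (simp only: power2_eq_square mult.assoc) linarith
  qed
  have q0: "0 < s / n" using s0 n by simp
  have lo: "0 < s / n * (1 - \<theta>)\<^sup>2" by (rule mult_pos_pos[OF q0]) (use th in simp)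
  obtain g where g: "s / n * (1 - \<theta>)\<^sup>2 \<le> g" "g \<le> s / n * (1 + \<theta>)\<^sup>2" and gn: "g ^ n = (\<Prod>k<n. m k)"
    using geometric_mean_bounds[where m = m, OF n lo mbound] by blast
  have g0: "0 < g" using g(1) lo by linarith
  have m0: "0 < m k" if "k < n" for k using mbound[OF that] lo by linarith

  define L where "L = U * mat_diag p (\<lambda>l. complex_of_real (sqrt (x l))) * mat_adjoint U"
  \<comment> \<open>\<open>R\<close> is diagonal in the eigenbasis \<open>V\<close> of \<Phi> X,
    hence commutes with it, and R (\<Phi> X) R is g times the identity.\<close>
  define R where "R = V * mat_diag n (\<lambda>k. complex_of_real (sqrt (g / m k))) * mat_adjoint V"
  have Lc: "L \<in> carrier_mat p p" unfolding L_def by (rule unitary_sandwich_carrier[OF U mat_diag_dim])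
  have Rc: "R \<in> carrier_mat n n" unfolding R_def by (rule unitary_sandwich_carrier[OF V mat_diag_dim])
  have Ladj: "mat_adjoint L = L" unfolding L_def using hermitian_unitary_diag[OF U] unfolding hermitian_mat_def .
  have Radj: "mat_adjoint R = R" unfolding R_def using hermitian_unitary_diag[OF V] unfolding hermitian_mat_def .
  have diag_cong: "mat_diag N d = mat_diag N d'" if "\<And>i. i < N \<Longrightarrow> d i = d' i"
    for N and d d' :: "nat \<Rightarrow> complex"
    by (rule eq_matI) (use that in \<open>auto simp: mat_diag_def\<close>)
  have LL: "mat_adjoint L * L = X"
  proof -
    have "mat_adjoint L * L
        = U * mat_diag p (\<lambda>l. complex_of_real (sqrt (x l)) * complex_of_real (sqrt (x l))) * mat_adjoint U"
      unfolding Ladj unfolding L_def by (rule unitary_diag_mult[OF U])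
    also have "mat_diag p (\<lambda>l. complex_of_real (sqrt (x l)) * complex_of_real (sqrt (x l)))
        = mat_diag p (\<lambda>l. complex_of_real (x l))"
      by (rule diag_cong) (simp add: x0 less_imp_le flip: of_real_mult)
    finally show ?thesis unfolding Xx .
  qed
  have RR: "mat_adjoint R * R = V * mat_diag n (\<lambda>k. complex_of_real (g / m k)) * mat_adjoint V"
  proof -
    have "mat_adjoint R * R = V * mat_diag n (\<lambda>k. complex_of_real (sqrt (g / m k)) * complex_of_real (sqrt (g / m k)))
        * mat_adjoint V"
      unfolding Radj unfolding R_def by (rule unitary_diag_mult[OF V])
    also have "mat_diag n (\<lambda>k. complex_of_real (sqrt (g / m k)) * complex_of_real (sqrt (g / m k)))
        = mat_diag n (\<lambda>k. complex_of_real (g / m k))"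
      by (rule diag_cong) (simp add: m0 g0 less_imp_le flip: of_real_mult)
    finally show ?thesis .
  qed
  have detL: "det L = 1" unfolding L_def det_unitary_diag[OF U] prod_sqrt prodx by simp
  have detR: "det R = 1"
  proof -
    have "(\<Prod>k<n. g / m k) = g ^ n / (\<Prod>k<n. m k)" by (simp add: prod_dividef)
    also have "\<dots> = 1" unfolding gn[symmetric] using g0 by simp
    finally have "(\<Prod>k<n. g / m k) = 1" .
    then show ?thesis unfolding R_def det_unitary_diag[OF V] prod_sqrt by simp
  qed
  have RKR: "R * kraus_map n As (mat_adjoint L * L) * mat_adjoint R
      = V * mat_diag n (\<lambda>_. complex_of_real g) * mat_adjoint V"
  proof -
    have "R * kraus_map n As (mat_adjoint L * L) * mat_adjoint R
        = V * mat_diag n (\<lambda>k. complex_of_real (sqrt (g / m k)) * complex_of_real (m k)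
            * complex_of_real (sqrt (g / m k))) * mat_adjoint V"
      unfolding Radj LL Km unfolding R_def unitary_diag_mult[OF V] ..
    also have "mat_diag n (\<lambda>k. complex_of_real (sqrt (g / m k)) * complex_of_real (m k)
            * complex_of_real (sqrt (g / m k))) = mat_diag n (\<lambda>_. complex_of_real g)"
    proof (rule diag_cong)
      fix k assume k: "k < n"
      have "sqrt (g / m k) * m k * sqrt (g / m k) = (sqrt (g / m k) * sqrt (g / m k)) * m k"
        by (simp only: mult_ac)
      also have "\<dots> = g" using m0[OF k] g0 by (simp add: less_imp_le)
      finally show "complex_of_real (sqrt (g / m k)) * complex_of_real (m k) * complex_of_real (sqrt (g / m k))
          = complex_of_real g" unfolding of_real_mult[symmetric] by (rule arg_cong)
    qed
    finally show ?thesis .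
  qed
  let ?\<Psi> = "scaling \<Phi> L R"
  have \<Psi>1: "?\<Psi> (1\<^sub>m p) = V * mat_diag n (\<lambda>_. complex_of_real g) * mat_adjoint V"
  proof -
    have "mat_adjoint L * 1\<^sub>m p * L = mat_adjoint L * L"
      unfolding right_mult_one_mat[OF mat_adjoint_carrier[OF Lc]] ..
    then show ?thesis unfolding scaling_def RKR[symmetric] by (simp only: LL \<Phi>[OF Xc])
  qed
  have size: "map_size p ?\<Psi> = n * g"
    unfolding map_size_def \<Psi>1 mat_trace_unitary_sandwich[OF V mat_diag_dim] mat_trace_mat_diag by simp
  have bal1: "op_norm_mat (?\<Psi> (1\<^sub>m p) - complex_of_real (map_size p ?\<Psi> / real n) \<cdot>\<^sub>m 1\<^sub>m n) \<le> 0"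
    unfolding \<Psi>1 unitary_diag_minus_scalar[OF V]
    by (rule op_norm_unitary_diag_le[OF V]) (use n in \<open>simp_all add: size\<close>)
  have bal2: "op_norm_mat (dual_map p n ?\<Psi> (1\<^sub>m n) - complex_of_real (map_size p ?\<Psi> / real p) \<cdot>\<^sub>m 1\<^sub>m p) \<le> 0"
    unfolding dual_map_eq[OF kraus_rep_scaling[OF rep Lc Rc] one_carrier_mat] size
  proof (rule balanced_dual_at_minimum[OF As p n Lc detL Rc detR _ _ g0])
    \<comment> \<open>The strict inequality \<theta> \<le> 1/4 < 1/3 places the minimiser in the
      interior of the ball, as the first-order conditions require.\<close>
    show "frob_norm (mat_adjoint L * L - 1\<^sub>m p) < 1 / 3" unfolding LL using fX th by simp
    show "g ^ n \<le> Re (det (kraus_map n As Y))" if "Y \<in> herm_det_ball p (1 / 3)" for Y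
    proof -
      have "g ^ n = F X" unfolding F_def Km det_unitary_diag[OF V] gn by (simp only: Re_complex_of_real)
      then show ?thesis using min[OF that] unfolding F_def by simp
    qed
    show "R * kraus_map n As (mat_adjoint L * L) * mat_adjoint R = complex_of_real g \<cdot>\<^sub>m 1\<^sub>m n"
      unfolding RKR by (rule unitary_diag_scalar[OF V])
  qed
  have bal: "doubly_balanced p n ?\<Psi>"
    unfolding doubly_balanced_def eps_doubly_balanced_def using bal1 bal2 by simp
  have boundL: "frob_norm (1\<^sub>m p - mat_adjoint L * L) \<le> 200 * \<tau>"
    unfolding LL frob_norm_swap_minus[OF one_carrier_mat Xc] using fX t0 unfolding \<theta>_def by simp
  have "op_norm_mat (1\<^sub>m n - mat_adjoint R * R) \<le> 8 * \<theta>"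
    unfolding RR unfolding unitary_diag_one[OF V, symmetric] unitary_diag_diff[OF V]
  proof (rule op_norm_unitary_diag_le[OF V])
    fix k assume k: "k < n"
    have "cmod (complex_of_real (1 - g / m k)) \<le> 8 * \<theta>"
      unfolding norm_of_real using ratio_close_to_one[OF q0 th g] mbound[OF k] by blast
    then show "cmod (1 - complex_of_real (g / m k)) \<le> 8 * \<theta>" by simp
  qed (use th in simp)
  then have boundR: "op_norm_mat (1\<^sub>m n - mat_adjoint R * R) \<le> 200 * \<tau>" using t0 unfolding \<theta>_def by simp
  show ?thesis
    using Lc Rc detL detR bal boundL boundR unfolding \<tau>_def
    by (intro exI[of _ L] exI[of _ R] conjI)
qed

section \<open>Maps of size zero and the final theorem\<close>

lemma map_size_nonneg:
  assumes rep: "kraus_rep p n \<Phi> As"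
  shows "0 \<le> map_size p \<Phi>"
proof -
  have As: "set As \<subseteq> carrier_mat n p" and \<Phi>: "\<Phi> (1\<^sub>m p) = kraus_map n As (mat_diag p (\<lambda>_. 1))"
    using rep unfolding kraus_rep_def by auto
  have "mat_trace (\<Phi> (1\<^sub>m p)) = (\<Sum>k<n. \<Sum>l<p. of_real (kraus_weight As k l) * 1)"
    unfolding mat_trace_def \<Phi>
    by (intro sum.cong kraus_map_diag_index[OF As]) (simp_all add: kraus_map_def)
  then have "map_size p \<Phi> = (\<Sum>k<n. \<Sum>l<p. kraus_weight As k l)" unfolding map_size_def by simp
  then show ?thesis by (simp add: sum_nonneg kraus_weight_nonneg)
qed

text \<open>At size zero the balance tolerances s * \<epsilon> / n and s * \<epsilon> / p vanish for
  every \<epsilon>, so \<Phi> is already doubly balanced and the trivial scaling suffices.\<close>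

lemma doubly_balanced_scaling_one:
  assumes rep: "kraus_rep p n \<Phi> As" and bal: "eps_doubly_balanced p n \<epsilon> \<Phi>" and s: "map_size p \<Phi> = 0"
  shows "doubly_balanced p n (scaling \<Phi> (1\<^sub>m p) (1\<^sub>m n))"
proof -
  let ?\<Psi> = "scaling \<Phi> (1\<^sub>m p) (1\<^sub>m n)"
  have As: "set As \<subseteq> carrier_mat n p" and \<Phi>: "\<And>Y. Y \<in> carrier_mat p p \<Longrightarrow> \<Phi> Y = kraus_map n As Y"
    using rep unfolding kraus_rep_def by auto
  have eq: "?\<Psi> Y = \<Phi> Y" if Y: "Y \<in> carrier_mat p p" for Y
    unfolding scaling_def mat_adjoint_one left_mult_one_mat[OF Y] right_mult_one_mat[OF Y] \<Phi>[OF Y]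
      left_mult_one_mat[OF kraus_map_carrier] right_mult_one_mat[OF kraus_map_carrier] ..
  have rep': "kraus_rep p n ?\<Psi> As" using rep eq unfolding kraus_rep_def by simp
  have size: "map_size p ?\<Psi> = 0" using s eq[OF one_carrier_mat] unfolding map_size_def by simp
  show ?thesis
    using bal
    unfolding doubly_balanced_def eps_doubly_balanced_def size s eq[OF one_carrier_mat]
      dual_map_eq[OF rep one_carrier_mat] dual_map_eq[OF rep' one_carrier_mat] by simp
qed

theorem theorem2p12:
  shows "\<exists>c > (0::real). \<exists>C > (0::real).
    \<forall>(p::nat) (n::nat) (\<Phi> :: complex mat \<Rightarrow> complex mat) (\<epsilon>::real) (lam::real).
      p \<ge> 1 \<and> n \<ge> 1 \<and> completely_positive p n \<Phi> \<and>
      \<epsilon> \<ge> 0 \<and> 0 < lam \<and> lam \<le> 1 \<and>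
      quantum_expander p n \<epsilon> (1 - lam) \<Phi> \<and>
      \<epsilon> * sqrt (real p) / lam \<le> c
      \<longrightarrow>
      (\<exists>L R. L \<in> carrier_mat p p \<and> invertible_mat L \<and>
             R \<in> carrier_mat n n \<and> invertible_mat R \<and>
             det L = 1 \<and> det R = 1 \<and>
             doubly_balanced p n (scaling \<Phi> L R) \<and>
             frob_norm (1\<^sub>m p - mat_adjoint L * L) \<le> C * (\<epsilon> * sqrt (real p) / lam) \<and>
             op_norm_mat (1\<^sub>m n - mat_adjoint R * R) \<le> C * (\<epsilon> * sqrt (real p) / lam))"
proof (rule exI[of _ "1 / 100"], rule conjI, simp, rule exI[of _ 200], rule conjI, simp, intro allI impI)
  fix p n :: nat and \<Phi> :: "complex mat \<Rightarrow> complex mat" and \<epsilon> lam :: real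
  assume A: "p \<ge> 1 \<and> n \<ge> 1 \<and> completely_positive p n \<Phi> \<and> \<epsilon> \<ge> 0 \<and> 0 < lam \<and> lam \<le> 1 \<and>
    quantum_expander p n \<epsilon> (1 - lam) \<Phi> \<and> \<epsilon> * sqrt (real p) / lam \<le> 1 / 100"
  then obtain As where rep: "kraus_rep p n \<Phi> As" unfolding completely_positive_def by blast
  have "\<exists>L R. L \<in> carrier_mat p p \<and> R \<in> carrier_mat n n \<and> det L = 1 \<and> det R = 1 \<and>
    doubly_balanced p n (scaling \<Phi> L R) \<and>
    frob_norm (1\<^sub>m p - mat_adjoint L * L) \<le> 200 * (\<epsilon> * sqrt p / lam) \<and>
    op_norm_mat (1\<^sub>m n - mat_adjoint R * R) \<le> 200 * (\<epsilon> * sqrt p / lam)"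
  \<comment> \<open>The main argument divides by the size, so size zero is treated separately, with
    both factors equal to the identity.\<close>
  proof (cases "map_size p \<Phi> = 0")
    case False
    then have "0 < map_size p \<Phi>" using map_size_nonneg[OF rep] by simp
    then show ?thesis using A by (intro expander_scaling[OF _ _ rep]) auto
  next
    case True
    have bal: "doubly_balanced p n (scaling \<Phi> (1\<^sub>m p) (1\<^sub>m n))"
      using A by (intro doubly_balanced_scaling_one[OF rep _ True, of \<epsilon>]) (simp add: quantum_expander_def)
    have nn: "0 \<le> 200 * (\<epsilon> * sqrt p / lam)" using A by simp
    have one: "mat_adjoint (1\<^sub>m N) * 1\<^sub>m N = (1\<^sub>m N :: complex mat)" for N
      by (simp only: mat_adjoint_one left_mult_one_mat[OF one_carrier_mat])
    have "frob_norm (1\<^sub>m p - 1\<^sub>m p) = 0"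
      using frob_norm_unitary_diag_minus_one[OF unitary_mat_one, of p "\<lambda>_. 1"]
        unitary_diag_one[OF unitary_mat_one[of p]] by simp
    then have frob: "frob_norm (1\<^sub>m p - mat_adjoint (1\<^sub>m p) * 1\<^sub>m p) \<le> 200 * (\<epsilon> * sqrt p / lam)"
      unfolding one using nn by (simp only:)
    have diff: "1\<^sub>m n - 1\<^sub>m n = 1\<^sub>m n * mat_diag n (\<lambda>_. 1 - 1 :: complex) * mat_adjoint (1\<^sub>m n)"
      using unitary_diag_diff[OF unitary_mat_one, of n "\<lambda>_. 1" "\<lambda>_. 1"]
      unfolding unitary_diag_one[OF unitary_mat_one] .
    have "op_norm_mat (1\<^sub>m n - mat_adjoint (1\<^sub>m n) * 1\<^sub>m n) \<le> 200 * (\<epsilon> * sqrt p / lam)"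
      unfolding one diff by (rule op_norm_unitary_diag_le[OF unitary_mat_one]) (use nn in simp_all)
    with bal frob show ?thesis
      by (intro exI[of _ "1\<^sub>m p"] exI[of _ "1\<^sub>m n"] conjI one_carrier_mat det_one)
  qed
  then obtain L R where LR: "L \<in> carrier_mat p p" "R \<in> carrier_mat n n" "det L = 1" "det R = 1"
      "doubly_balanced p n (scaling \<Phi> L R)"
      "frob_norm (1\<^sub>m p - mat_adjoint L * L) \<le> 200 * (\<epsilon> * sqrt p / lam)"
      "op_norm_mat (1\<^sub>m n - mat_adjoint R * R) \<le> 200 * (\<epsilon> * sqrt p / lam)"
    by (elim exE conjE)
  show "\<exists>L R. L \<in> carrier_mat p p \<and> invertible_mat L \<and> R \<in> carrier_mat n n \<and> invertible_mat R \<and>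
      det L = 1 \<and> det R = 1 \<and> doubly_balanced p n (scaling \<Phi> L R) \<and>
      frob_norm (1\<^sub>m p - mat_adjoint L * L) \<le> 200 * (\<epsilon> * sqrt (real p) / lam) \<and>
      op_norm_mat (1\<^sub>m n - mat_adjoint R * R) \<le> 200 * (\<epsilon> * sqrt (real p) / lam)"
    by (intro exI[of _ L] exI[of _ R] conjI LR invertible_mat_det_one[OF LR(1,3)] invertible_mat_det_one[OF LR(2,4)])
qed

end
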